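(* There is an absolute constant $c<26$ such that for every integer $n\ge 1$, every $\alpha\in(-1/n,0]$ and all $f,g,h\in C_\alpha(\mathbb{R}^n)$, $$\|f\|_1\,\|f\star_\alpha g\star_\alpha h\|_1\le \frac{c^n}{\prod_{j=1}^n(1+j\alpha)^2}\,\|f\star_\alpha g\|_1\,\|f\star_\alpha h\|_1 .$$
   Context: For $\alpha\in[-\infty,0]$, a function $f:\mathbb{R}^n\to[0,\infty)$ is $\alpha$-concave if for all $x,y$ with $f(x),f(y)>0$ and all $\lambda\in[0,1]$, $f(\lambda x+(1-\lambda)y)\ge[\lambda f(x)^\alpha+(1-\lambda)f(y)^\alpha]^{1/\alpha}$, where the right side is read as $f(x)^\lambda f(y)^{1-\lambda}$ for $\alpha=0$ and as $\min\{f(x),f(y)\}$ for $\alpha=-\infty$. $C_\alpha(\mathbb{R}^n)$ is the set of upper semicontinuous $\alpha$-concave $f:\mathbb{R}^n\to[0,\infty)$ with $\|f\|_\infty=f(0)=1$ and $\lim_{|x|\to\infty}f(x)=0$. The $\alpha$-sum is $(f\star_\alpha g)(x)=\sup_{y+z=x}(f(y)^\alpha+g(z)^\alpha-1)^{1/\alpha}$ for $-\infty<\alpha<0$ (the expression is $0$ whenever $f(y)=0$ or $g(z)=0$), and $(f\star_0 g)(x)=\sup_{y+z=x}f(y)g(z)$. The operation is associative and commutative. $\|f\|_1=\int_{\mathbb{R}^n}f(x)\,dx$ for $f\ge 0$. *)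

theory Defs
  imports "HOL-Analysis.Analysis"
begin

text \<open>
  The constant in the theorem must not depend on the dimension, so the dimension has to be an
  ordinary natural number that can be quantified inside a formula. Therefore
  \<open>\<real>\<^sup>n\<close> is the set of extensional functions on \<open>{..<n}\<close>, which is both the
  \<^const>\<open>topspace\<close> of the product topology and the \<^const>\<open>space\<close> of the product
  Lebesgue--Borel measure used below. Functions on \<open>\<real>\<^sup>n\<close> are total HOL functions whose
  values outside this set are irrelevant.
\<close>

type_synonym vect = "nat \<Rightarrow> real"

definition Rn :: "nat \<Rightarrow> vect set" where
  "Rn n = {..<n} \<rightarrow>\<^sub>E UNIV"

definition vzero :: "nat \<Rightarrow> vect" where
  "vzero n = (\<lambda>i\<in>{..<n}. 0)"

definition vadd :: "nat \<Rightarrow> vect \<Rightarrow> vect \<Rightarrow> vect" where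
  "vadd n x y = (\<lambda>i\<in>{..<n}. x i + y i)"

definition vscale :: "nat \<Rightarrow> real \<Rightarrow> vect \<Rightarrow> vect" where
  "vscale n t x = (\<lambda>i\<in>{..<n}. t * x i)"

definition vnorm :: "nat \<Rightarrow> vect \<Rightarrow> real" where
  "vnorm n x = L2_set x {..<n}"

definition Rn_topology :: "nat \<Rightarrow> vect topology" where
  "Rn_topology n = product_topology (\<lambda>_. euclideanreal) {..<n}"

definition Rn_lborel :: "nat \<Rightarrow> vect measure" where
  "Rn_lborel n = PiM {..<n} (\<lambda>_. lborel)"

definition upper_semicontinuous_map :: "'a topology \<Rightarrow> ('a \<Rightarrow> real) \<Rightarrow> bool" where
  "upper_semicontinuous_map X f \<longleftrightarrow> (\<forall>t. openin X {x \<in> topspace X. f x < t})"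

definition alpha_mean :: "ereal \<Rightarrow> real \<Rightarrow> real \<Rightarrow> real \<Rightarrow> real" where
  "alpha_mean \<alpha> t a b =
     (if \<alpha> = -\<infinity> then min a b
      else if \<alpha> = 0 then a powr t * b powr (1 - t)
      else (t * a powr real_of_ereal \<alpha> + (1 - t) * b powr real_of_ereal \<alpha>)
             powr (1 / real_of_ereal \<alpha>))"

definition alpha_concave :: "nat \<Rightarrow> ereal \<Rightarrow> (vect \<Rightarrow> real) \<Rightarrow> bool" where
  "alpha_concave n \<alpha> f \<longleftrightarrow>
     (\<forall>x\<in>Rn n. \<forall>y\<in>Rn n. \<forall>t\<in>{0..1}. f x > 0 \<longrightarrow> f y > 0 \<longrightarrow>
        f (vadd n (vscale n t x) (vscale n (1 - t) y)) \<ge> alpha_mean \<alpha> t (f x) (f y))"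

text \<open>The supremum is taken in \<^typ>\<open>ereal\<close>, as \<^const>\<open>Sup\<close> on the reals
  is unspecified for unbounded sets.\<close>

definition sup_norm :: "nat \<Rightarrow> (vect \<Rightarrow> real) \<Rightarrow> ereal" where
  "sup_norm n f = (SUP x\<in>Rn n. ereal \<bar>f x\<bar>)"

definition C_alpha :: "nat \<Rightarrow> ereal \<Rightarrow> (vect \<Rightarrow> real) set" where
  "C_alpha n \<alpha> =
     {f. (\<forall>x\<in>Rn n. 0 \<le> f x) \<and>
         upper_semicontinuous_map (Rn_topology n) f \<and>
         alpha_concave n \<alpha> f \<and>
         sup_norm n f = 1 \<and> f (vzero n) = 1 \<and>
         (f \<longlongrightarrow> 0) (inf (principal (Rn n)) (filtercomap (vnorm n) at_top))}"

definition alpha_sum_term :: "real \<Rightarrow> real \<Rightarrow> real \<Rightarrow> real" where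
  "alpha_sum_term \<alpha> a b =
     (if \<alpha> = 0 then a * b
      else if a = 0 \<or> b = 0 then 0
      else (a powr \<alpha> + b powr \<alpha> - 1) powr (1 / \<alpha>))"

text \<open>For functions with values in \<open>[0,1]\<close>, and \<open>\<alpha> \<le> 0\<close>, all terms lie in
  \<open>[0,1]\<close>, so this is a genuine real supremum, including for iterated sums.\<close>

definition alpha_sum ::
    "nat \<Rightarrow> real \<Rightarrow> (vect \<Rightarrow> real) \<Rightarrow> (vect \<Rightarrow> real) \<Rightarrow> vect \<Rightarrow> real" where
  "alpha_sum n \<alpha> f g x =
     Sup {alpha_sum_term \<alpha> (f y) (g z) | y z. y \<in> Rn n \<and> z \<in> Rn n \<and> vadd n y z = x}"

text \<open>Taken in \<^typ>\<open>ennreal\<close>, so that no integrability is presupposed.\<close>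

definition L1_norm :: "nat \<Rightarrow> (vect \<Rightarrow> real) \<Rightarrow> ennreal" where
  "L1_norm n f = (\<integral>\<^sup>+ x. ennreal (f x) \<partial>Rn_lborel n)"

end

theory Submission
  imports Defs
begin

text \<open>
  The constant $16$ works. The proof has two independent halves: an inequality for log-concave
  functions, with constant $4^n$ and without any further loss, and a comparison of integrals that
  reduces every $\alpha$ to the log-concave case.

  \<^bold>\<open>Reduction to log-concave functions.\<close> Let
  $S_\alpha(t) = (1 + \alpha \ln t)^{1/\alpha}$ (\<open>log_to_alpha\<close>), the increasing bijection of
  $[0,1]$ that turns products into $\alpha$-sums; $S_0$ is the identity. A function in $C_\alpha$ is
  $S_\alpha \circ f'$ with $f'$ log-concave, and the $\alpha$-sum of $S_\alpha \circ f'$ and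
  $S_\alpha \circ g'$ is $S_\alpha$ applied to the sup-convolution $f' \star_0 g'$. Let $\alpha < 0$.
  With $m = -1/\alpha$ and $t = e^{-v}$ one has
  $S_\alpha(t) = (1 + v/m)^{-m}$. On the one hand this is at least $t$. On the other hand it is the
  Laplace transform of a Gamma distribution, that is, $S_\alpha(t)$ is the mean of $t^\lambda$ for
  $\lambda$ Gamma distributed with shape and rate $m$. Log-concavity and $f'(0) = 1$ give
  $f'(x)^\lambda \le f'(\lambda x)$ for $\lambda \le 1$, hence
  $\int f'^\lambda \le (1 + \lambda^{-n}) \int f'$ for every $\lambda > 0$. The mean of $\lambda^{-n}$
  is exactly $1 / \prod_{j \le n} (1 + j \alpha)$, and this product is at most $1$; so
  $\int S_\alpha \circ f' \le 2 / \prod_{j \le n} (1 + j \alpha) \cdot \int f'$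
  (\<open>L1_norm_log_to_alpha_le\<close>). Applying this to the two factors on the left, and
  $t \le S_\alpha(t)$ to the two factors on the right, costs
  $4 / \prod_{j \le n} (1 + j \alpha)^2$, and $4 \cdot 4^n \le 16^n$.

  \<^bold>\<open>The log-concave case.\<close> Put $F = f \star_0 g$, $G = f \star_0 h$ and
  $H = f \star_0 g \star_0 h$. Let $y = a + b + c$ be an optimal splitting, $H(y) = f(a) g(b) h(c)$.
  For all $s$ and $u$ the point $y + u/2$ is the sum of $(a + (u - s))/2 + b$ and $(a + s)/2 + c$, so
  by log-concavity of $f$ the product of $F$ at the first and $G$ at the second point is at least
  $H(y) \sqrt{f(s) f(u - s)}$ (\<open>sup_convolution_product_lower\<close>). Since $\int F \int G$ is the
  integral of $F(y + u/2 - z) G(z)$ over $y$ and $z$, this gives for every $u$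
  \[ \int F \int G \ge 2^{-n} \int H \cdot \int \sqrt{f(s) f(u - s)}\, ds . \]
  It remains to find a good $u$. Averaging over $u$ with weight $f(u/2)$, which is at least
  $\sqrt{f(s) f(u - s)}$ and has total mass $2^n \int f$, shows that some value of the last integral
  is at least $2^{-n} \int f$ (\<open>log_concave_ruzsa_inequality\<close>).

  Upper semicontinuity and decay at infinity enter through compactness of superlevel sets: this makes
  sup-convolutions attained, and makes them functions of the same class, in particular measurable.
\<close>

section \<open>Vector operations and compact superlevel sets\<close>

definition vsub :: "nat \<Rightarrow> vect \<Rightarrow> vect \<Rightarrow> vect" where
  "vsub n x y = (\<lambda>i\<in>{..<n}. x i - y i)"

lemma Rn_closed [simp]:
  "vadd n x y \<in> Rn n" "vsub n x y \<in> Rn n" "vscale n t x \<in> Rn n" "vzero n \<in> Rn n"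
  by (auto simp: Rn_def vadd_def vsub_def vscale_def vzero_def)

lemmas vect_defs = vadd_def vsub_def vscale_def vzero_def

lemma Rn_eqI: "x \<in> Rn n \<Longrightarrow> y \<in> Rn n \<Longrightarrow> (\<And>i. i < n \<Longrightarrow> x i = y i) \<Longrightarrow> x = y"
  unfolding Rn_def by (rule PiE_ext) auto

lemma topspace_Rn [simp]: "topspace (Rn_topology n) = Rn n"
  by (simp add: Rn_topology_def Rn_def)

lemma Hausdorff_Rn: "Hausdorff_space (Rn_topology n)"
  by (simp add: Rn_topology_def Hausdorff_space_product_topology)

lemma continuous_map_vadd:
  "continuous_map (prod_topology (Rn_topology n) (Rn_topology n)) (Rn_topology n)
     (\<lambda>p. vadd n (fst p) (snd p))"
proof -
  have proj: "continuous_map (Rn_topology n) euclideanreal (\<lambda>x. x i)" if "i < n" for i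
    unfolding Rn_topology_def using that by (intro continuous_map_product_projection) auto
  have "continuous_map (prod_topology (Rn_topology n) (Rn_topology n)) euclideanreal
          (\<lambda>p. fst p i + snd p i)" if "i < n" for i
    using continuous_map_compose[OF continuous_map_fst proj[OF that], of "Rn_topology n"]
      continuous_map_compose[OF continuous_map_snd proj[OF that], of "Rn_topology n"]
    by (intro continuous_map_add) (auto simp: o_def)
  then show ?thesis
    by (subst (3) Rn_topology_def) (auto simp: continuous_map_componentwise vadd_def)
qed

text \<open>
  Upper semicontinuity makes the superlevel set closed and decay at infinity makes it bounded, so it
  is a closed subset of a compact cube.
\<close>

lemma C_alpha_superlevel_compact:
  assumes "f \<in> C_alpha n \<alpha>" "t > 0"
  shows "compactin (Rn_topology n) {x \<in> Rn n. t \<le> f x}"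
proof -
  have usc: "openin (Rn_topology n) {x \<in> Rn n. f x < t}"
    and lim: "(f \<longlongrightarrow> 0) (inf (principal (Rn n)) (filtercomap (vnorm n) at_top))"
    using assms by (auto simp: C_alpha_def upper_semicontinuous_map_def)
  have "eventually (\<lambda>x. f x < t) (inf (principal (Rn n)) (filtercomap (vnorm n) at_top))"
    using lim \<open>t > 0\<close> by (rule order_tendstoD(2))
  then have "eventually (\<lambda>x. x \<in> Rn n \<longrightarrow> f x < t) (filtercomap (vnorm n) at_top)"
    by (simp add: inf_commute[of "principal _"] eventually_inf_principal)
  then obtain R where R: "\<And>x. x \<in> Rn n \<Longrightarrow> vnorm n x \<ge> R \<Longrightarrow> f x < t"
    unfolding eventually_filtercomap eventually_at_top_linorder by blast
  have "{x \<in> Rn n. t \<le> f x} \<subseteq> PiE {..<n} (\<lambda>_. {-R..R})"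
  proof (clarsimp simp: Rn_def PiE_iff)
    fix x i assume x: "x \<in> extensional {..<n}" "t \<le> f x" and i: "i < n"
    have "vnorm n x < R"
      using R[of x] x by (auto simp: Rn_def PiE_iff not_le[symmetric])
    moreover have "\<bar>x i\<bar> \<le> vnorm n x"
    proof -
      have "vnorm n x = L2_set (\<lambda>i. \<bar>x i\<bar>) {..<n}" by (simp add: vnorm_def L2_set_def)
      then show ?thesis using i by (auto intro: member_le_L2_set)
    qed
    ultimately show "- R \<le> x i \<and> x i \<le> R" by linarith
  qed
  moreover have "compactin (Rn_topology n) (PiE {..<n} (\<lambda>_. {-R..R}))"
    by (simp add: Rn_topology_def compactin_PiE)
  moreover have "closedin (Rn_topology n) {x \<in> Rn n. t \<le> f x}"
  proof -
    have "Rn n - {x \<in> Rn n. t \<le> f x} = {x \<in> Rn n. f x < t}" by auto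
    then show ?thesis using usc by (auto simp: closedin_def)
  qed
  ultimately show ?thesis by (blast intro: closed_compactin)
qed

text \<open>
  If no point of $K$ were a maximizer, the open sets $\{u < u(y)\}$ with $y \in K$ would cover $K$.
  Among the finitely many $y$ of a subcover, one with the largest $u(y)$ lies in none of the sets of
  the subcover.
\<close>

lemma usc_attains_maximum_on_compact:
  fixes u :: "'a \<Rightarrow> real"
  assumes K: "compactin X K" "K \<noteq> {}"
    and usc: "\<And>t. openin X {x \<in> topspace X. u x < t}"
  obtains x where "x \<in> K" "\<And>y. y \<in> K \<Longrightarrow> u y \<le> u x"
proof -
  have "\<exists>x\<in>K. \<forall>y\<in>K. u y \<le> u x"
  proof (rule ccontr)
    assume "\<not> ?thesis"
    then have *: "\<exists>y\<in>K. u x < u y" if "x \<in> K" for x using that by (auto simp: not_le)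
    define U where "U y = {x \<in> topspace X. u x < u y}" for y
    have "K \<subseteq> \<Union>(U ` K)"
      using * compactin_subset_topspace[OF K(1)] by (fastforce simp: U_def)
    then obtain \<F> where \<F>: "finite \<F>" "\<F> \<subseteq> U ` K" "K \<subseteq> \<Union>\<F>"
      using compactinD[OF K(1), of "U ` K"] usc by (auto simp: U_def)
    then obtain Y where Y: "Y \<subseteq> K" "finite Y" "\<F> = U ` Y"
      by (metis finite_subset_image)
    have "Y \<noteq> {}" using \<F> Y K(2) by auto
    then have mx: "Max (u ` Y) \<in> u ` Y" using Y by (intro Max_in) auto
    then obtain y where y: "y \<in> Y" "u y = Max (u ` Y)" by auto
    then obtain z where "z \<in> Y" "u y < u z" using \<F> Y by (auto simp: U_def)
    moreover have "u z \<le> Max (u ` Y)" using \<open>z \<in> Y\<close> Y by (intro Max_ge) auto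
    ultimately show False using y by simp
  qed
  then show ?thesis using that by blast
qed

section \<open>Peaked log-concave functions and their sup-convolution\<close>

text \<open>
  The log-concave counterpart of \<open>C_alpha\<close> in the form in which it is used. Compactness of the
  superlevel sets replaces upper semicontinuity and decay, because it passes to images under addition.
  As \<open>0 powr 0 = 0\<close>, the concavity inequality also holds where $f$ vanishes.
\<close>

definition peaked_log_concave :: "nat \<Rightarrow> (vect \<Rightarrow> real) \<Rightarrow> bool" where
  "peaked_log_concave n f \<longleftrightarrow>
     (\<forall>x\<in>Rn n. 0 \<le> f x \<and> f x \<le> 1) \<and> f (vzero n) = 1 \<and>
     (\<forall>t>0. compactin (Rn_topology n) {x \<in> Rn n. t \<le> f x}) \<and>
     (\<forall>x\<in>Rn n. \<forall>y\<in>Rn n. \<forall>t\<in>{0..1}.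
        f x powr t * f y powr (1 - t) \<le> f (vadd n (vscale n t x) (vscale n (1 - t) y)))"

lemma peaked_log_concaveD:
  assumes "peaked_log_concave n f"
  shows "x \<in> Rn n \<Longrightarrow> 0 \<le> f x" "x \<in> Rn n \<Longrightarrow> f x \<le> 1" "f (vzero n) = 1"
    "t > 0 \<Longrightarrow> compactin (Rn_topology n) {x \<in> Rn n. t \<le> f x}"
    "x \<in> Rn n \<Longrightarrow> y \<in> Rn n \<Longrightarrow> 0 \<le> s \<Longrightarrow> s \<le> 1 \<Longrightarrow>
       f x powr s * f y powr (1 - s) \<le> f (vadd n (vscale n s x) (vscale n (1 - s) y))"
  using assms by (auto simp: peaked_log_concave_def)

lemma peaked_log_concave_usc:
  assumes "peaked_log_concave n f"
  shows "openin (Rn_topology n) {x \<in> Rn n. f x < t}"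
proof (cases "t > 0")
  case True
  have "closedin (Rn_topology n) {x \<in> Rn n. t \<le> f x}"
    by (rule compactin_imp_closedin[OF Hausdorff_Rn peaked_log_concaveD(4)[OF assms True]])
  moreover have "{x \<in> Rn n. f x < t} = Rn n - {x \<in> Rn n. t \<le> f x}" by auto
  ultimately show ?thesis by (metis openin_diff openin_topspace topspace_Rn)
next
  case False
  have "\<not> f x < t" if "x \<in> Rn n" for x using peaked_log_concaveD(1)[OF assms that] False by linarith
  then have "{x \<in> Rn n. f x < t} = {}" by auto
  then show ?thesis by (simp only: openin_empty)
qed

text \<open>
  For functions with values in $[0,1]$, increasing both factors by $e \le 1$ increases the product by
  at most $3 e$; hence a product of two strict sublevel sets is a neighbourhood.
\<close>

lemma product_usc:
  assumes f: "peaked_log_concave n f" and g: "peaked_log_concave n g"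
  shows "openin (prod_topology (Rn_topology n) (Rn_topology n))
           {p \<in> Rn n \<times> Rn n. f (fst p) * g (snd p) < t}"
  unfolding openin_prod_topology_alt
proof (intro allI impI)
  fix y z assume "(y, z) \<in> {p \<in> Rn n \<times> Rn n. f (fst p) * g (snd p) < t}"
  then have y: "y \<in> Rn n" and z: "z \<in> Rn n" and lt: "f y * g z < t" by auto
  note B = peaked_log_concaveD(1,2)[OF f] peaked_log_concaveD(1,2)[OF g]
  define e where "e = min 1 ((t - f y * g z) / 3)"
  have e: "e > 0" "e \<le> 1" "3 * e \<le> t - f y * g z" using lt by (auto simp: e_def min_def)
  have *: "(f y + e) * (g z + e) \<le> t"
  proof -
    have "e * f y \<le> e * 1" "e * g z \<le> e * 1" "e * e \<le> e * 1"
      using B y z e by (intro mult_left_mono; simp)+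
    moreover have "(f y + e) * (g z + e) = f y * g z + e * f y + e * g z + e * e"
      by (simp add: algebra_simps)
    ultimately show ?thesis using e(3) by linarith
  qed
  show "\<exists>U V. openin (Rn_topology n) U \<and> openin (Rn_topology n) V \<and> y \<in> U \<and> z \<in> V \<and>
           U \<times> V \<subseteq> {p \<in> Rn n \<times> Rn n. f (fst p) * g (snd p) < t}"
  proof (intro exI conjI)
    show "openin (Rn_topology n) {x \<in> Rn n. f x < f y + e}" by (rule peaked_log_concave_usc[OF f])
    show "openin (Rn_topology n) {x \<in> Rn n. g x < g z + e}" by (rule peaked_log_concave_usc[OF g])
    show "{x \<in> Rn n. f x < f y + e} \<times> {x \<in> Rn n. g x < g z + e}
            \<subseteq> {p \<in> Rn n \<times> Rn n. f (fst p) * g (snd p) < t}"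
    proof clarsimp
      fix a b assume ab: "a \<in> Rn n" "f a < f y + e" "b \<in> Rn n" "g b < g z + e"
      have "f a * g b < (f y + e) * (g z + e)"
        using ab B e y z by (intro mult_strict_mono') auto
      with * show "f a * g b < t" by simp
    qed
  qed (use y z e in auto)
qed

lemma product_superlevel_compact:
  assumes f: "peaked_log_concave n f" and g: "peaked_log_concave n g" and t: "t > 0"
  shows "compactin (prod_topology (Rn_topology n) (Rn_topology n))
           {p \<in> Rn n \<times> Rn n. t \<le> f (fst p) * g (snd p)}"
proof (rule closed_compactin)
  show "compactin (prod_topology (Rn_topology n) (Rn_topology n))
          ({x \<in> Rn n. t \<le> f x} \<times> {x \<in> Rn n. t \<le> g x})"
    using peaked_log_concaveD(4)[OF f t] peaked_log_concaveD(4)[OF g t] by (simp add: compactin_Times)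
  show "{p \<in> Rn n \<times> Rn n. t \<le> f (fst p) * g (snd p)}
          \<subseteq> {x \<in> Rn n. t \<le> f x} \<times> {x \<in> Rn n. t \<le> g x}"
  proof clarsimp
    fix a b assume ab: "a \<in> Rn n" "b \<in> Rn n" "t \<le> f a * g b"
    have "f a * g b \<le> f a * 1" "f a * g b \<le> 1 * g b"
      using ab peaked_log_concaveD(1,2)[OF f] peaked_log_concaveD(1,2)[OF g] by (auto intro: mult_left_le mult_left_le_one_le)
    with ab show "t \<le> f a \<and> t \<le> g b" by simp
  qed
  have "Rn n \<times> Rn n - {p \<in> Rn n \<times> Rn n. t \<le> f (fst p) * g (snd p)}
        = {p \<in> Rn n \<times> Rn n. f (fst p) * g (snd p) < t}" by auto
  then show "closedin (prod_topology (Rn_topology n) (Rn_topology n))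
               {p \<in> Rn n \<times> Rn n. t \<le> f (fst p) * g (snd p)}"
    using product_usc[OF f g] by (auto simp: closedin_def)
qed

text \<open>
  If some splitting of $x$ gives a positive value, the splittings that do at least as well form a
  compact set, on which the upper semicontinuous product attains its maximum. Otherwise every
  splitting gives $0$ and is optimal.
\<close>

lemma sup_convolution_maximizer:
  assumes f: "peaked_log_concave n f" and g: "peaked_log_concave n g" and x: "x \<in> Rn n"
  obtains y z where "y \<in> Rn n" "z \<in> Rn n" "vadd n y z = x"
    "\<And>y' z'. y' \<in> Rn n \<Longrightarrow> z' \<in> Rn n \<Longrightarrow> vadd n y' z' = x \<Longrightarrow> f y' * g z' \<le> f y * g z"
proof (cases "\<exists>y\<in>Rn n. \<exists>z\<in>Rn n. vadd n y z = x \<and> f y * g z > 0")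
  case True
  then obtain y0 z0 where 0: "y0 \<in> Rn n" "z0 \<in> Rn n" "vadd n y0 z0 = x" "f y0 * g z0 > 0"
    by blast
  let ?X = "prod_topology (Rn_topology n) (Rn_topology n)"
  let ?L = "{p \<in> Rn n \<times> Rn n. f y0 * g z0 \<le> f (fst p) * g (snd p)}"
  let ?D = "{p \<in> topspace ?X. vadd n (fst p) (snd p) \<in> {x}}"
  have "closedin ?X ?D"
    using x by (intro closedin_continuous_map_preimage[OF continuous_map_vadd]
      closedin_Hausdorff_singleton[OF Hausdorff_Rn]) auto
  then have K: "compactin ?X (?L \<inter> ?D)"
    by (intro compact_Int_closedin product_superlevel_compact[OF f g 0(4)])
  have "(y0, z0) \<in> ?L \<inter> ?D" using 0 by auto
  then have ne: "?L \<inter> ?D \<noteq> {}" by blast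
  obtain p where p: "p \<in> ?L \<inter> ?D"
      "\<And>q. q \<in> ?L \<inter> ?D \<Longrightarrow> f (fst q) * g (snd q) \<le> f (fst p) * g (snd p)"
    by (rule usc_attains_maximum_on_compact[OF K ne, of "\<lambda>p. f (fst p) * g (snd p)"])
       (use product_usc[OF f g] in \<open>auto\<close>)
  show ?thesis
  proof (rule that[of "fst p" "snd p"])
    fix y' z' assume h: "y' \<in> Rn n" "z' \<in> Rn n" "vadd n y' z' = x"
    show "f y' * g z' \<le> f (fst p) * g (snd p)"
    proof (cases "f y0 * g z0 \<le> f y' * g z'")
      case True
      then show ?thesis using p(2)[of "(y', z')"] h by auto
    next
      case False
      then show ?thesis using p(1) by auto
    qed
  qed (use p in auto)
next
  case False
  show ?thesis
  proof (rule that[of x "vzero n"])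
    show "vadd n x (vzero n) = x" using x by (intro Rn_eqI[of _ n], simp, simp, simp add: vect_defs)
    fix y' z' assume "y' \<in> Rn n" "z' \<in> Rn n" "vadd n y' z' = x"
    then have "f y' * g z' \<le> 0" using False by (auto simp: not_less)
    also have "0 \<le> f x * g (vzero n)" using x peaked_log_concaveD(1)[OF f] peaked_log_concaveD(1)[OF g] by simp
    finally show "f y' * g z' \<le> f x * g (vzero n)" .
  qed (use x in auto)
qed

section \<open>Passing between products and \<open>\<alpha>\<close>-sums\<close>

text \<open>
  The bijection of $[0,1]$ under which multiplication corresponds to \<open>alpha_sum_term\<close>. For
  $\alpha < 0$ the value of the formula at $0$ has to be set by hand, as it is the limit at $0$.
\<close>

definition log_to_alpha :: "real \<Rightarrow> real \<Rightarrow> real" where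
  "log_to_alpha \<alpha> t =
     (if t = 0 then 0 else if \<alpha> = 0 then t else (1 + \<alpha> * ln t) powr (1 / \<alpha>))"

lemma one_le_log_to_alpha_base:
  fixes \<alpha> t :: real
  assumes "\<alpha> \<le> 0" "0 < t" "t \<le> 1"
  shows "1 \<le> 1 + \<alpha> * ln t"
  using assms by (simp add: mult_nonpos_nonpos)

lemma log_to_alpha_pos: "\<alpha> \<le> 0 \<Longrightarrow> 0 < t \<Longrightarrow> t \<le> 1 \<Longrightarrow> 0 < log_to_alpha \<alpha> t"
  using one_le_log_to_alpha_base[of \<alpha> t] by (auto simp: log_to_alpha_def)

lemma log_to_alpha_nonneg: "\<alpha> \<le> 0 \<Longrightarrow> 0 \<le> t \<Longrightarrow> 0 \<le> log_to_alpha \<alpha> t"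
  by (simp add: log_to_alpha_def)

lemma log_to_alpha_powr:
  "\<alpha> < 0 \<Longrightarrow> 0 < t \<Longrightarrow> t \<le> 1 \<Longrightarrow> log_to_alpha \<alpha> t powr \<alpha> = 1 + \<alpha> * ln t"
  using one_le_log_to_alpha_base[of \<alpha> t] by (simp add: log_to_alpha_def powr_powr)

lemma log_to_alpha_mono:
  assumes "\<alpha> \<le> 0" "0 \<le> s" "s \<le> t" "t \<le> 1"
  shows "log_to_alpha \<alpha> s \<le> log_to_alpha \<alpha> t"
proof (cases "s = 0 \<or> \<alpha> = 0")
  case True
  then show ?thesis using assms log_to_alpha_nonneg[of \<alpha> t] by (auto simp: log_to_alpha_def)
next
  case False
  then have "\<alpha> * ln t \<le> \<alpha> * ln s" using assms by (intro mult_left_mono_neg) auto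
  then show ?thesis
    using False assms one_le_log_to_alpha_base[of \<alpha> t]
    by (auto simp: log_to_alpha_def intro!: powr_mono2')
qed

text \<open>
  Both sides raised to the power $\alpha$ are $1 + \alpha \ln s + \alpha \ln t$.
\<close>

lemma alpha_sum_term_log_to_alpha:
  assumes "\<alpha> \<le> 0" "0 \<le> s" "s \<le> 1" "0 \<le> t" "t \<le> 1"
  shows "alpha_sum_term \<alpha> (log_to_alpha \<alpha> s) (log_to_alpha \<alpha> t) = log_to_alpha \<alpha> (s * t)"
proof (cases "s = 0 \<or> t = 0 \<or> \<alpha> = 0")
  case True
  then show ?thesis by (auto simp: log_to_alpha_def alpha_sum_term_def)
next
  case False
  then have "log_to_alpha \<alpha> s \<noteq> 0" "log_to_alpha \<alpha> t \<noteq> 0"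
    using log_to_alpha_pos[of \<alpha> s] log_to_alpha_pos[of \<alpha> t] assms by auto
  moreover have "ln (s * t) = ln s + ln t" using False assms by (simp add: ln_mult)
  ultimately show ?thesis
    using False assms log_to_alpha_powr[of \<alpha> s] log_to_alpha_powr[of \<alpha> t]
    by (simp add: alpha_sum_term_def log_to_alpha_def[of \<alpha> "s * t"] algebra_simps)
qed

text \<open>
  Since \<open>log_to_alpha\<close> is increasing, a splitting that is optimal for the product of $f$ and $g$
  is also optimal for the $\alpha$-sum of the transformed functions.
\<close>

lemma alpha_sum_log_to_alpha_attained:
  assumes f: "peaked_log_concave n f" and g: "peaked_log_concave n g" and \<alpha>: "\<alpha> \<le> 0"
    and F: "\<And>x. x \<in> Rn n \<Longrightarrow> F x = log_to_alpha \<alpha> (f x)"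
    and G: "\<And>x. x \<in> Rn n \<Longrightarrow> G x = log_to_alpha \<alpha> (g x)"
    and yz: "y \<in> Rn n" "z \<in> Rn n" "vadd n y z = x"
    and max: "\<And>y' z'. y' \<in> Rn n \<Longrightarrow> z' \<in> Rn n \<Longrightarrow> vadd n y' z' = x \<Longrightarrow> f y' * g z' \<le> f y * g z"
  shows "alpha_sum n \<alpha> F G x = log_to_alpha \<alpha> (f y * g z)"
proof -
  note B = peaked_log_concaveD(1,2)[OF f] peaked_log_concaveD(1,2)[OF g]
  have termeq: "alpha_sum_term \<alpha> (F y') (G z') = log_to_alpha \<alpha> (f y' * g z')"
    if "y' \<in> Rn n" "z' \<in> Rn n" for y' z'
    using that B by (simp add: F G alpha_sum_term_log_to_alpha[OF \<alpha>])
  show ?thesis unfolding alpha_sum_def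
  proof (rule cSup_eq_maximum)
    show "log_to_alpha \<alpha> (f y * g z)
        \<in> {alpha_sum_term \<alpha> (F y) (G z) |y z. y \<in> Rn n \<and> z \<in> Rn n \<and> vadd n y z = x}"
      using yz termeq[of y z] by force
  next
    fix v assume "v \<in> {alpha_sum_term \<alpha> (F y) (G z) |y z. y \<in> Rn n \<and> z \<in> Rn n \<and> vadd n y z = x}"
    then obtain y' z' where h: "y' \<in> Rn n" "z' \<in> Rn n" "vadd n y' z' = x"
      and v: "v = alpha_sum_term \<alpha> (F y') (G z')" by blast
    have "v = log_to_alpha \<alpha> (f y' * g z')" using v termeq h by simp
    also have "\<dots> \<le> log_to_alpha \<alpha> (f y * g z)"
      using h yz B max[OF h] by (intro log_to_alpha_mono \<alpha>) (auto intro: mult_le_one)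
    finally show "v \<le> log_to_alpha \<alpha> (f y * g z)" .
  qed
qed

lemma sup_convolution_attained:
  assumes f: "peaked_log_concave n f" and g: "peaked_log_concave n g" and x: "x \<in> Rn n"
  obtains y z where "y \<in> Rn n" "z \<in> Rn n" "vadd n y z = x" "alpha_sum n 0 f g x = f y * g z"
    "\<And>y' z'. y' \<in> Rn n \<Longrightarrow> z' \<in> Rn n \<Longrightarrow> vadd n y' z' = x \<Longrightarrow> f y' * g z' \<le> f y * g z"
proof -
  obtain y z where h: "y \<in> Rn n" "z \<in> Rn n" "vadd n y z = x"
    "\<And>y' z'. y' \<in> Rn n \<Longrightarrow> z' \<in> Rn n \<Longrightarrow> vadd n y' z' = x \<Longrightarrow> f y' * g z' \<le> f y * g z"
    by (rule sup_convolution_maximizer[OF f g x]) (rule that)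
  have "alpha_sum n 0 f g x = log_to_alpha 0 (f y * g z)"
    by (rule alpha_sum_log_to_alpha_attained[OF f g]) (use h in \<open>auto simp: log_to_alpha_def\<close>)
  then show ?thesis using h by (intro that[of y z]) (auto simp: log_to_alpha_def)
qed

lemma sup_convolution_upper:
  assumes f: "peaked_log_concave n f" and g: "peaked_log_concave n g"
    and "y \<in> Rn n" "z \<in> Rn n" "vadd n y z = x"
  shows "f y * g z \<le> alpha_sum n 0 f g x"
proof -
  have "x \<in> Rn n" using assms by auto
  from sup_convolution_attained[OF f g this] show ?thesis using assms by metis
qed

lemma alpha_sum_log_to_alpha:
  assumes f: "peaked_log_concave n f" and g: "peaked_log_concave n g" and \<alpha>: "\<alpha> \<le> 0"
    and F: "\<And>x. x \<in> Rn n \<Longrightarrow> F x = log_to_alpha \<alpha> (f x)"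
    and G: "\<And>x. x \<in> Rn n \<Longrightarrow> G x = log_to_alpha \<alpha> (g x)" and x: "x \<in> Rn n"
  shows "alpha_sum n \<alpha> F G x = log_to_alpha \<alpha> (alpha_sum n 0 f g x)"
proof -
  obtain y z where h: "y \<in> Rn n" "z \<in> Rn n" "vadd n y z = x" "alpha_sum n 0 f g x = f y * g z"
    "\<And>y' z'. y' \<in> Rn n \<Longrightarrow> z' \<in> Rn n \<Longrightarrow> vadd n y' z' = x \<Longrightarrow> f y' * g z' \<le> f y * g z"
    by (rule sup_convolution_attained[OF f g x]) (rule that)
  show ?thesis
    unfolding h(4) by (rule alpha_sum_log_to_alpha_attained[OF f g \<alpha> F G h(1-3,5)])
qed

text \<open>
  A superlevel set of the sup-convolution is the image under addition of a superlevel set of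
  $(y, z) \mapsto f(y) g(z)$, precisely because the supremum is attained; so it is compact.
  Log-concavity follows by combining optimal splittings of the two points.
\<close>

lemma peaked_log_concave_sup_convolution:
  assumes f: "peaked_log_concave n f" and g: "peaked_log_concave n g"
  shows "peaked_log_concave n (alpha_sum n 0 f g)"
proof -
  let ?F = "alpha_sum n 0 f g"
  note B = peaked_log_concaveD(1,2)[OF f] peaked_log_concaveD(1,2)[OF g]
  have bounds: "0 \<le> ?F x \<and> ?F x \<le> 1" if x: "x \<in> Rn n" for x
    by (rule sup_convolution_attained[OF f g x]) (use B in \<open>auto intro: mult_le_one\<close>)
  have "vadd n (vzero n) (vzero n) = vzero n" by (simp add: vect_defs fun_eq_iff)
  then have "?F (vzero n) \<ge> 1"
    using sup_convolution_upper[OF f g, of "vzero n" "vzero n"] peaked_log_concaveD(3)[OF f] peaked_log_concaveD(3)[OF g] by simp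
  then have zero: "?F (vzero n) = 1" using bounds[of "vzero n"] by simp
  have compact: "compactin (Rn_topology n) {x \<in> Rn n. t \<le> ?F x}" if t: "t > 0" for t
  proof -
    have "{x \<in> Rn n. t \<le> ?F x} =
        (\<lambda>p. vadd n (fst p) (snd p)) ` {p \<in> Rn n \<times> Rn n. t \<le> f (fst p) * g (snd p)}"
      (is "?A = ?B")
    proof (intro equalityI subsetI)
      fix x assume x: "x \<in> ?A"
      then have xR: "x \<in> Rn n" by simp
      obtain y z where "y \<in> Rn n" "z \<in> Rn n" "vadd n y z = x" "?F x = f y * g z"
        by (rule sup_convolution_attained[OF f g xR]) (rule that)
      then show "x \<in> ?B" using x by (intro image_eqI[of _ _ "(y, z)"]) auto
    next
      fix x assume "x \<in> ?B"
      then obtain y z where "y \<in> Rn n" "z \<in> Rn n" "x = vadd n y z" "t \<le> f y * g z" by auto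
      then show "x \<in> ?A" using sup_convolution_upper[OF f g, of y z x] by auto
    qed
    then show ?thesis
      using image_compactin[OF product_superlevel_compact[OF f g t] continuous_map_vadd] by simp
  qed
  have concave: "?F x powr t * ?F y powr (1 - t) \<le> ?F (vadd n (vscale n t x) (vscale n (1 - t) y))"
    if x: "x \<in> Rn n" and y: "y \<in> Rn n" and t: "t \<in> {0..1}" for x y t
  proof -
    obtain a b where ab: "a \<in> Rn n" "b \<in> Rn n" "vadd n a b = x" "?F x = f a * g b"
      by (rule sup_convolution_attained[OF f g x]) (rule that)
    obtain c d where cd: "c \<in> Rn n" "d \<in> Rn n" "vadd n c d = y" "?F y = f c * g d"
      by (rule sup_convolution_attained[OF f g y]) (rule that)
    let ?c = "\<lambda>p q. vadd n (vscale n t p) (vscale n (1 - t) q)"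
    have "?F x powr t * ?F y powr (1 - t)
        = (f a powr t * f c powr (1 - t)) * (g b powr t * g d powr (1 - t))"
      using ab cd B by (simp add: powr_mult)
    also have "\<dots> \<le> f (?c a c) * g (?c b d)"
      using peaked_log_concaveD(5)[OF f, of a c t] peaked_log_concaveD(5)[OF g, of b d t] ab cd t B by (intro mult_mono) auto
    also have "\<dots> \<le> ?F (?c x y)"
      unfolding ab(3)[symmetric] cd(3)[symmetric]
      by (intro sup_convolution_upper[OF f g], simp, simp,
          simp add: vect_defs fun_eq_iff algebra_simps)
    finally show ?thesis .
  qed
  show ?thesis
    unfolding peaked_log_concave_def using bounds zero compact concave by blast
qed

section \<open>\<open>\<alpha>\<close>-concave functions as transformed log-concave functions\<close>

text \<open>
  The inverse of \<open>log_to_alpha\<close> on $[0,1]$.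
\<close>

definition alpha_to_log :: "real \<Rightarrow> real \<Rightarrow> real" where
  "alpha_to_log \<alpha> a =
     (if a = 0 then 0 else if \<alpha> = 0 then a else exp ((a powr \<alpha> - 1) / \<alpha>))"

lemma one_le_powr_neg:
  fixes a \<alpha> :: real
  assumes "\<alpha> \<le> 0" "0 < a" "a \<le> 1"
  shows "1 \<le> a powr \<alpha>"
  using powr_mono2'[of \<alpha> a 1] assms by simp

lemma alpha_to_log_bounds:
  assumes "\<alpha> \<le> 0" "0 \<le> a" "a \<le> 1"
  shows "0 \<le> alpha_to_log \<alpha> a" "alpha_to_log \<alpha> a \<le> 1"
  using assms one_le_powr_neg[of \<alpha> a] by (auto simp: alpha_to_log_def divide_nonneg_nonpos)

lemma log_to_alpha_inverse:
  assumes "\<alpha> \<le> 0" "0 \<le> a" "a \<le> 1"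
  shows "log_to_alpha \<alpha> (alpha_to_log \<alpha> a) = a"
  using assms by (auto simp: alpha_to_log_def log_to_alpha_def powr_powr)

lemma alpha_to_log_inverse:
  assumes "\<alpha> \<le> 0" "0 < t" "t \<le> 1"
  shows "alpha_to_log \<alpha> (log_to_alpha \<alpha> t) = t"
  using assms log_to_alpha_pos[OF assms] log_to_alpha_powr[of \<alpha> t]
  by (cases "\<alpha> = 0") (auto simp: alpha_to_log_def, simp add: log_to_alpha_def)

lemma alpha_to_log_mono:
  assumes "\<alpha> \<le> 0" "0 \<le> a" "a \<le> b"
  shows "alpha_to_log \<alpha> a \<le> alpha_to_log \<alpha> b"
proof (cases "a = 0 \<or> \<alpha> = 0")
  case True
  then show ?thesis using assms by (auto simp: alpha_to_log_def)
next
  case False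
  then have "b powr \<alpha> \<le> a powr \<alpha>" using assms by (intro powr_mono2') auto
  then have "(a powr \<alpha> - 1) / \<alpha> \<le> (b powr \<alpha> - 1) / \<alpha>"
    using assms by (intro divide_right_mono_neg) auto
  then show ?thesis using False assms by (auto simp: alpha_to_log_def)
qed

lemma le_alpha_to_log_iff:
  assumes \<alpha>: "\<alpha> \<le> 0" and t: "0 < t" "t \<le> 1" and a: "0 \<le> a" "a \<le> 1"
  shows "t \<le> alpha_to_log \<alpha> a \<longleftrightarrow> log_to_alpha \<alpha> t \<le> a"
proof
  assume "t \<le> alpha_to_log \<alpha> a"
  then have "log_to_alpha \<alpha> t \<le> log_to_alpha \<alpha> (alpha_to_log \<alpha> a)"
    using t alpha_to_log_bounds[OF \<alpha> a] by (intro log_to_alpha_mono \<alpha>) auto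
  then show "log_to_alpha \<alpha> t \<le> a" by (simp add: log_to_alpha_inverse[OF \<alpha> a])
next
  assume "log_to_alpha \<alpha> t \<le> a"
  then have "alpha_to_log \<alpha> (log_to_alpha \<alpha> t) \<le> alpha_to_log \<alpha> a"
    using log_to_alpha_pos[OF \<alpha> t] by (intro alpha_to_log_mono \<alpha>) auto
  then show "t \<le> alpha_to_log \<alpha> a" by (simp add: alpha_to_log_inverse[OF \<alpha> t])
qed

text \<open>
  For $\alpha < 0$, $\alpha$-concavity of $f$ says that $f^\alpha$ is convex, that is, that the
  logarithm $(f^\alpha - 1)/\alpha$ of the transformed function is concave.
\<close>

lemma C_alpha_log_concave_transform:
  assumes f: "f \<in> C_alpha n (ereal \<alpha>)" and \<alpha>: "\<alpha> \<le> 0"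
  shows "peaked_log_concave n (\<lambda>x. alpha_to_log \<alpha> (f x))"
    and "\<And>x. x \<in> Rn n \<Longrightarrow> f x = log_to_alpha \<alpha> (alpha_to_log \<alpha> (f x))"
proof -
  have nonneg: "0 \<le> f x" if "x \<in> Rn n" for x using f that by (auto simp: C_alpha_def)
  have le1: "f x \<le> 1" if "x \<in> Rn n" for x
  proof -
    have "ereal \<bar>f x\<bar> \<le> sup_norm n f" unfolding sup_norm_def using that by (rule SUP_upper)
    also have "\<dots> = 1" using f by (auto simp: C_alpha_def)
    finally show ?thesis by simp
  qed
  show "f x = log_to_alpha \<alpha> (alpha_to_log \<alpha> (f x))" if "x \<in> Rn n" for x
    using nonneg[OF that] le1[OF that] by (simp add: log_to_alpha_inverse \<alpha>)
  have compact: "compactin (Rn_topology n) {x \<in> Rn n. t \<le> alpha_to_log \<alpha> (f x)}" if t: "t > 0" for t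
  proof (cases "t \<le> 1")
    case True
    have "{x \<in> Rn n. t \<le> alpha_to_log \<alpha> (f x)} = {x \<in> Rn n. log_to_alpha \<alpha> t \<le> f x}"
      using le_alpha_to_log_iff[OF \<alpha> t True] nonneg le1 by auto
    then show ?thesis
      using C_alpha_superlevel_compact[OF f log_to_alpha_pos[OF \<alpha> t True]] by simp
  next
    case False
    have "\<not> t \<le> alpha_to_log \<alpha> (f x)" if "x \<in> Rn n" for x
      using alpha_to_log_bounds(2)[OF \<alpha> nonneg[OF that] le1[OF that]] False by linarith
    then have "{x \<in> Rn n. t \<le> alpha_to_log \<alpha> (f x)} = {}" by auto
    then show ?thesis by (metis compactin_empty)
  qed
  have concave: "alpha_to_log \<alpha> (f x) powr t * alpha_to_log \<alpha> (f y) powr (1 - t)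
      \<le> alpha_to_log \<alpha> (f (vadd n (vscale n t x) (vscale n (1 - t) y)))"
    if x: "x \<in> Rn n" and y: "y \<in> Rn n" and t: "t \<in> {0..1}" for x y t
  proof (cases "f x = 0 \<or> f y = 0")
    case True
    have "0 \<le> alpha_to_log \<alpha> (f (vadd n (vscale n t x) (vscale n (1 - t) y)))"
      by (rule alpha_to_log_bounds[OF \<alpha> nonneg le1]) auto
    then show ?thesis using True by (auto simp: alpha_to_log_def[of _ 0])
  next
    case False
    define w where "w = vadd n (vscale n t x) (vscale n (1 - t) y)"
    have pos: "0 < f x" "0 < f y" using False nonneg x y by (auto simp: less_le)
    then have mean: "alpha_mean (ereal \<alpha>) t (f x) (f y) \<le> f w"
      using f x y t by (auto simp: C_alpha_def alpha_concave_def w_def)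
    show ?thesis
    proof (cases "\<alpha> = 0")
      case True
      then show ?thesis
        using mean pos by (auto simp: alpha_mean_def alpha_to_log_def zero_ereal_def w_def)
    next
      case False
      define q where "q = t * f x powr \<alpha> + (1 - t) * f y powr \<alpha>"
      have "1 \<le> q"
        using one_le_powr_neg[OF \<alpha> pos(1) le1[OF x]] one_le_powr_neg[OF \<alpha> pos(2) le1[OF y]] t
          convex_bound_le[of "- (f x powr \<alpha>)" "-1" "- (f y powr \<alpha>)" t "1 - t"]
        by (simp add: q_def)
      then have q: "q powr (1 / \<alpha>) \<le> f w" "0 < q powr (1 / \<alpha>)"
        using mean False by (auto simp: alpha_mean_def q_def zero_ereal_def)
      have "alpha_to_log \<alpha> (f x) powr t * alpha_to_log \<alpha> (f y) powr (1 - t)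
          = exp (t * ((f x powr \<alpha> - 1) / \<alpha>)) * exp ((1 - t) * ((f y powr \<alpha> - 1) / \<alpha>))"
        using pos False by (simp add: alpha_to_log_def powr_def)
      also have "\<dots> = exp ((q - 1) / \<alpha>)"
        unfolding exp_add[symmetric] using False by (simp add: q_def field_simps)
      also have "\<dots> = alpha_to_log \<alpha> (q powr (1 / \<alpha>))"
        using q(2) False \<open>1 \<le> q\<close> by (simp add: alpha_to_log_def powr_powr)
      also have "\<dots> \<le> alpha_to_log \<alpha> (f w)" using q by (intro alpha_to_log_mono \<alpha>) auto
      finally show ?thesis by (simp add: w_def)
    qed
  qed
  have "alpha_to_log \<alpha> (f (vzero n)) = 1" using f by (auto simp: C_alpha_def alpha_to_log_def)
  then show "peaked_log_concave n (\<lambda>x. alpha_to_log \<alpha> (f x))"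
    unfolding peaked_log_concave_def
    using compact concave alpha_to_log_bounds[OF \<alpha> nonneg le1] by blast
qed

section \<open>Measurability and changes of variables\<close>

lemma space_Rn_lborel [simp]: "space (Rn_lborel n) = Rn n"
  by (simp add: Rn_lborel_def Rn_def space_PiM)

lemma sigma_finite_Rn_lborel: "sigma_finite_measure (Rn_lborel n)"
proof -
  interpret product_sigma_finite "\<lambda>_::nat. lborel :: real measure" ..
  show ?thesis unfolding Rn_lborel_def by (rule sigma_finite) simp
qed

lemma nn_integral_Rn_swap:
  assumes "(\<lambda>p. \<phi> (fst p) (snd p)) \<in> borel_measurable (Rn_lborel n \<Otimes>\<^sub>M Rn_lborel n)"
  shows "(\<integral>\<^sup>+y. (\<integral>\<^sup>+x. \<phi> x y \<partial>Rn_lborel n) \<partial>Rn_lborel n) = (\<integral>\<^sup>+x. (\<integral>\<^sup>+y. \<phi> x y \<partial>Rn_lborel n) \<partial>Rn_lborel n)"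
  using assms sigma_finite_Rn_lborel
  by (intro pair_sigma_finite.Fubini') (auto simp: pair_sigma_finite_def case_prod_beta')

lemma measurable_vect_component:
  assumes "g \<in> measurable N (Rn_lborel n)" "i < n"
  shows "(\<lambda>x. g x i) \<in> borel_measurable N"
proof -
  have "(\<lambda>x. x i) \<in> measurable (Rn_lborel n) lborel"
    unfolding Rn_lborel_def using assms(2) by (intro measurable_component_singleton) auto
  from measurable_compose[OF assms(1) this] show ?thesis by simp
qed

lemma measurable_vect_ops [measurable (raw)]:
  assumes g: "g \<in> measurable N (Rn_lborel n)" and h: "h \<in> measurable N (Rn_lborel n)"
  shows "(\<lambda>x. vadd n (g x) (h x)) \<in> measurable N (Rn_lborel n)"
    and "(\<lambda>x. vsub n (g x) (h x)) \<in> measurable N (Rn_lborel n)"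
  unfolding vadd_def vsub_def Rn_lborel_def
  using measurable_vect_component[OF g] measurable_vect_component[OF h]
  by (auto intro!: measurable_restrict)

lemma measurable_vscale [measurable (raw)]:
  assumes g: "g \<in> measurable N (Rn_lborel n)"
  shows "(\<lambda>x. vscale n t (g x)) \<in> measurable N (Rn_lborel n)"
  unfolding vscale_def Rn_lborel_def
  using measurable_vect_component[OF g] by (auto intro!: measurable_restrict)

text \<open>
  For a product over a whole countable index type, open sets are known to be measurable. An open set
  of $\mathbb{R}^n$ is moved there by restriction and brought back by extension with zeros.
\<close>

lemma openin_Rn_measurable:
  assumes "openin (Rn_topology n) U"
  shows "U \<in> sets (Rn_lborel n)"
proof -
  define r :: "vect \<Rightarrow> vect" where "r x = restrict x {..<n}" for x
  define e :: "vect \<Rightarrow> vect" where "e x i = (if i < n then x i else 0)" for x i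
  have comp: "continuous_map euclidean euclideanreal (\<lambda>x::vect. x i)" for i
    by (simp add: continuous_on_product_coordinates)
  have "continuous_map euclidean (Rn_topology n) r"
    unfolding Rn_topology_def r_def
    using comp by (auto simp: continuous_map_componentwise)
  then have "openin euclidean {x \<in> topspace euclidean. r x \<in> U}"
    using assms by (rule openin_continuous_map_preimage)
  then have "open {x. r x \<in> U}" by simp
  then have "{x. r x \<in> U} \<in> sets (PiM UNIV (\<lambda>_::nat. borel :: real measure))"
    by (simp add: sets_PiM_equal_borel)
  moreover have "e \<in> measurable (Rn_lborel n) (PiM UNIV (\<lambda>_::nat. borel :: real measure))"
  proof (rule measurable_PiM_single')
    fix i
    have "(\<lambda>x. x i) \<in> borel_measurable (Rn_lborel n)" if "i < n"
      using measurable_vect_component[OF measurable_ident that] by simp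
    then show "(\<lambda>x. e x i) \<in> borel_measurable (Rn_lborel n)"
      by (cases "i < n") (auto simp: e_def)
  qed auto
  ultimately have "e -` {x. r x \<in> U} \<inter> space (Rn_lborel n) \<in> sets (Rn_lborel n)"
    by (rule measurable_sets[rotated])
  moreover have "r (e x) = x" if "x \<in> Rn n" for x
    using that by (auto simp: r_def e_def fun_eq_iff Rn_def PiE_iff extensional_def)
  then have "e -` {x. r x \<in> U} \<inter> space (Rn_lborel n) = U"
    using openin_subset[OF assms] by auto
  ultimately show ?thesis by simp
qed

lemma peaked_log_concave_measurable:
  assumes "peaked_log_concave n f"
  shows "f \<in> borel_measurable (Rn_lborel n)"
  using openin_Rn_measurable[OF peaked_log_concave_usc[OF assms]] by (simp add: borel_measurable_iff_less)

text \<open>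
  Induction on the index set, splitting off one coordinate with Fubini and changing variables in it.
\<close>

lemma nn_integral_PiM_affine:
  fixes v :: "'i \<Rightarrow> real"
  assumes "finite I" "c > 0" "\<phi> \<in> borel_measurable (PiM I (\<lambda>_. lborel))"
  shows "(\<integral>\<^sup>+x. \<phi> x \<partial>PiM I (\<lambda>_. lborel)) =
    ennreal (c ^ card I) * (\<integral>\<^sup>+x. \<phi> (\<lambda>i\<in>I. v i + c * x i) \<partial>PiM I (\<lambda>_. lborel))"
  using assms(1,3)
proof (induction I arbitrary: \<phi> rule: finite_induct)
  case empty
  then show ?case by (simp add: PiM_empty nn_integral_count_space_finite restrict_def)
next
  case (insert i I)
  interpret product_sigma_finite "\<lambda>_::'i. lborel :: real measure" ..
  note [measurable] = insert.prems
  define \<Psi> where "\<Psi> x = (\<integral>\<^sup>+y. \<phi> (x(i := v i + c * y)) \<partial>lborel)" for x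
  have upd: "(\<lambda>p. (fst p)(i := v i + c * snd p))
      \<in> measurable (PiM I (\<lambda>_. lborel) \<Otimes>\<^sub>M lborel) (PiM (insert i I) (\<lambda>_. lborel))"
    by (rule measurable_fun_upd[where J = I]) auto
  have \<Psi>: "\<Psi> \<in> borel_measurable (PiM I (\<lambda>_. lborel))"
    unfolding \<Psi>_def
    using measurable_compose[OF upd insert.prems]
    by (intro lborel.borel_measurable_nn_integral) (simp add: case_prod_beta')
  have aff: "(\<lambda>x. \<lambda>j\<in>insert i I. v j + c * x j)
      \<in> measurable (PiM (insert i I) (\<lambda>_. lborel)) (PiM (insert i I) (\<lambda>_. lborel))"
    by (intro measurable_restrict) simp
  have "(\<integral>\<^sup>+x. \<phi> x \<partial>PiM (insert i I) (\<lambda>_. lborel))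
      = (\<integral>\<^sup>+x. (\<integral>\<^sup>+y. \<phi> (x(i := y)) \<partial>lborel) \<partial>PiM I (\<lambda>_. lborel))"
    by (rule product_nn_integral_insert[OF insert.hyps(1,2) insert.prems])
  also have "\<dots> = (\<integral>\<^sup>+x. ennreal c * \<Psi> x \<partial>PiM I (\<lambda>_. lborel))"
  proof (rule nn_integral_cong)
    fix x assume x: "x \<in> space (PiM I (\<lambda>_. lborel :: real measure))"
    have "(\<lambda>y. x(i := y)) \<in> measurable lborel (PiM (insert i I) (\<lambda>_. lborel))"
      using x by (intro measurable_fun_upd[where J = I]) auto
    from measurable_compose[OF this insert.prems]
    have "(\<lambda>y. \<phi> (x(i := y))) \<in> borel_measurable borel" by (simp add: fun_upd_def)
    from nn_integral_real_affine[OF this, of c "v i"] \<open>c > 0\<close>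
    show "(\<integral>\<^sup>+y. \<phi> (x(i := y)) \<partial>lborel) = ennreal c * \<Psi> x" by (simp add: \<Psi>_def)
  qed
  also have "\<dots> = ennreal c * (\<integral>\<^sup>+x. \<Psi> x \<partial>PiM I (\<lambda>_. lborel))"
    by (rule nn_integral_cmult[OF \<Psi>])
  also have "\<dots> = ennreal c * (ennreal (c ^ card I)
      * (\<integral>\<^sup>+x. \<Psi> (\<lambda>j\<in>I. v j + c * x j) \<partial>PiM I (\<lambda>_. lborel)))"
    by (subst insert.IH[OF \<Psi>]) simp
  also have "\<dots> = ennreal (c ^ card (insert i I))
      * (\<integral>\<^sup>+x. \<Psi> (\<lambda>j\<in>I. v j + c * x j) \<partial>PiM I (\<lambda>_. lborel))"
    using insert.hyps \<open>c > 0\<close> by (simp add: ennreal_mult mult.assoc)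
  also have "(\<integral>\<^sup>+x. \<Psi> (\<lambda>j\<in>I. v j + c * x j) \<partial>PiM I (\<lambda>_. lborel))
      = (\<integral>\<^sup>+x. (\<integral>\<^sup>+y. \<phi> (\<lambda>j\<in>insert i I. v j + c * (x(i := y)) j) \<partial>lborel) \<partial>PiM I (\<lambda>_. lborel))"
  proof (intro nn_integral_cong)
    fix x
    have "(\<lambda>j\<in>I. v j + c * x j)(i := v i + c * y)
        = (\<lambda>j\<in>insert i I. v j + c * (x(i := y)) j)" for y
      using insert.hyps by (auto simp: fun_eq_iff)
    then show "\<Psi> (\<lambda>j\<in>I. v j + c * x j)
        = (\<integral>\<^sup>+y. \<phi> (\<lambda>j\<in>insert i I. v j + c * (x(i := y)) j) \<partial>lborel)"
      by (simp add: \<Psi>_def)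
  qed
  also have "\<dots> = (\<integral>\<^sup>+x. \<phi> (\<lambda>j\<in>insert i I. v j + c * x j) \<partial>PiM (insert i I) (\<lambda>_. lborel))"
    by (rule product_nn_integral_insert[OF insert.hyps(1,2) measurable_compose[OF aff insert.prems], symmetric])
  finally show ?case .
qed

lemma nn_integral_Rn_affine:
  assumes "\<phi> \<in> borel_measurable (Rn_lborel n)" "c > 0"
  shows "(\<integral>\<^sup>+x. \<phi> x \<partial>Rn_lborel n) =
    ennreal (c ^ n) * (\<integral>\<^sup>+x. \<phi> (vadd n v (vscale n c x)) \<partial>Rn_lborel n)"
proof -
  have "vadd n v (vscale n c x) = (\<lambda>i\<in>{..<n}. v i + c * x i)" for x
    by (auto simp: vect_defs fun_eq_iff)
  then show ?thesis
    using nn_integral_PiM_affine[of "{..<n}" c \<phi> v] assms by (simp add: Rn_lborel_def)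
qed

lemma nn_integral_Rn_translate:
  assumes "\<phi> \<in> borel_measurable (Rn_lborel n)" "v \<in> Rn n"
  shows "(\<integral>\<^sup>+x. \<phi> (vsub n x v) \<partial>Rn_lborel n) = (\<integral>\<^sup>+x. \<phi> x \<partial>Rn_lborel n)"
proof -
  have "vadd n (vscale n (-1) v) (vscale n 1 x) = vsub n x v" for x
    by (auto simp: vect_defs fun_eq_iff)
  then show ?thesis using nn_integral_Rn_affine[OF assms(1), of 1 "vscale n (-1) v"] by simp
qed

section \<open>The inequality for log-concave functions\<close>

text \<open>
  With an optimal splitting $y = a + b + c$ the shift is $k = c + a/2$. It does not depend on $s$ and
  $u$, so for fixed $y$ it disappears in the integral over $s$, and no measurable choice of $a$ and $c$
  as functions of $y$ is needed.
\<close>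

lemma sup_convolution_product_lower:
  assumes f: "peaked_log_concave n f" and g: "peaked_log_concave n g" and h: "peaked_log_concave n h"
    and y: "y \<in> Rn n"
  obtains k where "k \<in> Rn n"
    "\<And>s u. s \<in> Rn n \<Longrightarrow> u \<in> Rn n \<Longrightarrow>
       alpha_sum n 0 (alpha_sum n 0 f g) h y * (f s powr (1/2) * f (vsub n u s) powr (1/2))
       \<le> alpha_sum n 0 f g (vsub n (vadd n y (vscale n (1/2) u)) (vadd n k (vscale n (1/2) s)))
         * alpha_sum n 0 f h (vadd n k (vscale n (1/2) s))"
proof -
  note fg = peaked_log_concave_sup_convolution[OF f g]
  obtain p c where pc: "p \<in> Rn n" "c \<in> Rn n" "vadd n p c = y"
    "alpha_sum n 0 (alpha_sum n 0 f g) h y = alpha_sum n 0 f g p * h c"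
    by (rule sup_convolution_attained[OF fg h y]) (rule that)
  obtain a b where ab: "a \<in> Rn n" "b \<in> Rn n" "vadd n a b = p" "alpha_sum n 0 f g p = f a * g b"
    by (rule sup_convolution_attained[OF f g pc(1)]) (rule that)
  have y_eq: "y = vadd n (vadd n a b) c" by (simp add: ab pc)
  define k where "k = vadd n c (vscale n (1/2) a)"
  note B = peaked_log_concaveD(1,2)[OF f] peaked_log_concaveD(1,2)[OF g] peaked_log_concaveD(1,2)[OF h]
  have half: "f x powr (1/2) * f z powr (1/2) \<le> f (vadd n (vscale n (1/2) x) (vscale n (1/2) z))"
    if "x \<in> Rn n" "z \<in> Rn n" for x z
    using peaked_log_concaveD(5)[OF f that, of "1/2"] by simp
  have "alpha_sum n 0 (alpha_sum n 0 f g) h y * (f s powr (1/2) * f (vsub n u s) powr (1/2))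
       \<le> alpha_sum n 0 f g (vsub n (vadd n y (vscale n (1/2) u)) (vadd n k (vscale n (1/2) s)))
         * alpha_sum n 0 f h (vadd n k (vscale n (1/2) s))"
    (is "?H * _ \<le> alpha_sum n 0 f g ?x * alpha_sum n 0 f h ?z")
    if s: "s \<in> Rn n" and u: "u \<in> Rn n" for s u
  proof -
    let ?m1 = "vadd n (vscale n (1/2) a) (vscale n (1/2) (vsub n u s))"
    let ?m2 = "vadd n (vscale n (1/2) a) (vscale n (1/2) s)"
    have fa: "f a = f a powr (1/2) * f a powr (1/2)"
      using B(1)[OF ab(1)] by (simp add: powr_half_sqrt)
    have "?H * (f s powr (1/2) * f (vsub n u s) powr (1/2))
        = ((f a powr (1/2) * f (vsub n u s) powr (1/2)) * g b)
          * ((f a powr (1/2) * f s powr (1/2)) * h c)"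
      unfolding pc(4) ab(4) by (subst fa) (simp only: mult_ac)
    also have "\<dots> \<le> (f ?m1 * g b) * (f ?m2 * h c)"
      using half[OF ab(1), of "vsub n u s"] half[OF ab(1) s] B ab pc
      by (intro mult_mono mult_nonneg_nonneg) auto
    also have "\<dots> \<le> alpha_sum n 0 f g ?x * alpha_sum n 0 f h ?z"
    proof (intro mult_mono)
      show "f ?m1 * g b \<le> alpha_sum n 0 f g ?x"
        unfolding y_eq using ab(1,2)
        by (intro sup_convolution_upper[OF f g], simp, simp,
            simp add: vect_defs k_def fun_eq_iff field_simps)
      show "f ?m2 * h c \<le> alpha_sum n 0 f h ?z"
        using pc(2) by (intro sup_convolution_upper[OF f h], simp, simp,
            simp add: vect_defs k_def fun_eq_iff field_simps)
    qed (use B ab pc peaked_log_concaveD(1)[OF fg] in auto)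
    finally show ?thesis .
  qed
  then show ?thesis by (intro that[of k]) (auto simp: k_def)
qed

text \<open>
  For fixed $y$, the substitution $z = k + s/2$ in the integral of $F(y + u/2 - z) G(z)$ over $z$
  produces the factor $2^{-n}$ and the integrand bounded below by \<open>sup_convolution_product_lower\<close>.
  Exchanging the integrals and translating $y$ turns the double integral into $\int F \int G$.
\<close>

lemma L1_product_lower:
  assumes f: "peaked_log_concave n f" and g: "peaked_log_concave n g" and h: "peaked_log_concave n h"
    and u: "u \<in> Rn n"
  shows "ennreal ((1/2) ^ n) * (L1_norm n (alpha_sum n 0 (alpha_sum n 0 f g) h)
           * (\<integral>\<^sup>+s. ennreal (f s powr (1/2) * f (vsub n u s) powr (1/2)) \<partial>Rn_lborel n))
       \<le> L1_norm n (alpha_sum n 0 f g) * L1_norm n (alpha_sum n 0 f h)"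
proof -
  let ?M = "Rn_lborel n"
  define F where "F = alpha_sum n 0 f g"
  define G where "G = alpha_sum n 0 f h"
  define H where "H = alpha_sum n 0 F h"
  have pF: "peaked_log_concave n F" and pG: "peaked_log_concave n G" and pH: "peaked_log_concave n H"
    using f g h by (auto simp: F_def G_def H_def intro!: peaked_log_concave_sup_convolution)
  note [measurable] = peaked_log_concave_measurable[OF f] peaked_log_concave_measurable[OF pF] peaked_log_concave_measurable[OF pG] peaked_log_concave_measurable[OF pH]
  define w where "w = vscale n (1/2) u"
  have w: "w \<in> Rn n" by (simp add: w_def)
  have [measurable]: "w \<in> space ?M" "u \<in> space ?M" using w u by simp_all
  define K where "K = (\<integral>\<^sup>+s. ennreal (f s powr (1/2) * f (vsub n u s) powr (1/2)) \<partial>?M)"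
  have slice: "ennreal ((1/2) ^ n) * (ennreal (H y) * K)
      \<le> (\<integral>\<^sup>+z. ennreal (G z) * ennreal (F (vsub n (vadd n y w) z)) \<partial>?M)" if y: "y \<in> Rn n" for y
  proof -
    have [measurable]: "y \<in> space ?M" using y by simp
    obtain k where k: "k \<in> Rn n" "\<And>s u. s \<in> Rn n \<Longrightarrow> u \<in> Rn n \<Longrightarrow>
       H y * (f s powr (1/2) * f (vsub n u s) powr (1/2))
       \<le> F (vsub n (vadd n y (vscale n (1/2) u)) (vadd n k (vscale n (1/2) s)))
         * G (vadd n k (vscale n (1/2) s))"
      by (rule sup_convolution_product_lower[OF f g h y, folded F_def, folded G_def H_def]) (rule that)
    let ?\<phi> = "\<lambda>z. ennreal (G z) * ennreal (F (vsub n (vadd n y w) z))"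
    have "ennreal (H y) * K
        = (\<integral>\<^sup>+s. ennreal (H y) * ennreal (f s powr (1/2) * f (vsub n u s) powr (1/2)) \<partial>?M)"
      unfolding K_def by (rule nn_integral_cmult[symmetric]) measurable
    also have "\<dots> \<le> (\<integral>\<^sup>+s. ?\<phi> (vadd n k (vscale n (1/2) s)) \<partial>?M)"
    proof (rule nn_integral_mono)
      fix s assume "s \<in> space ?M"
      then have s: "s \<in> Rn n" by simp
      show "ennreal (H y) * ennreal (f s powr (1/2) * f (vsub n u s) powr (1/2))
          \<le> ?\<phi> (vadd n k (vscale n (1/2) s))"
        using k(2)[OF s u] peaked_log_concaveD(1)[OF pH y] peaked_log_concaveD(1)[OF pG] peaked_log_concaveD(1)[OF pF]
        by (simp add: ennreal_mult[symmetric] w_def mult.commute ennreal_leI)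
    qed
    finally have "ennreal ((1/2) ^ n) * (ennreal (H y) * K)
        \<le> ennreal ((1/2) ^ n) * (\<integral>\<^sup>+s. ?\<phi> (vadd n k (vscale n (1/2) s)) \<partial>?M)"
      by (rule mult_left_mono) simp
    also have "\<dots> = (\<integral>\<^sup>+z. ?\<phi> z \<partial>?M)"
      by (rule nn_integral_Rn_affine[symmetric]) auto
    finally show ?thesis .
  qed
  have "ennreal ((1/2) ^ n) * (L1_norm n H * K)
      = (\<integral>\<^sup>+y. ennreal ((1/2) ^ n) * (ennreal (H y) * K) \<partial>?M)"
    unfolding L1_norm_def by (simp add: nn_integral_cmult nn_integral_multc)
  also have "\<dots> \<le> (\<integral>\<^sup>+y. (\<integral>\<^sup>+z. ennreal (G z) * ennreal (F (vsub n (vadd n y w) z)) \<partial>?M) \<partial>?M)"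
    using slice by (intro nn_integral_mono) simp
  also have "\<dots> = (\<integral>\<^sup>+z. (\<integral>\<^sup>+y. ennreal (G z) * ennreal (F (vsub n (vadd n y w) z)) \<partial>?M) \<partial>?M)"
    by (rule nn_integral_Rn_swap) measurable
  also have "\<dots> = (\<integral>\<^sup>+z. ennreal (G z) * L1_norm n F \<partial>?M)"
  proof (rule nn_integral_cong)
    fix z assume [measurable]: "z \<in> space ?M"
    have eq: "vsub n (vadd n y w) z = vsub n y (vsub n z w)" for y
      by (auto simp: vect_defs fun_eq_iff)
    have "(\<integral>\<^sup>+y. ennreal (F (vsub n (vadd n y w) z)) \<partial>?M) = L1_norm n F"
      unfolding eq L1_norm_def by (rule nn_integral_Rn_translate) auto
    then show "(\<integral>\<^sup>+y. ennreal (G z) * ennreal (F (vsub n (vadd n y w) z)) \<partial>?M)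
        = ennreal (G z) * L1_norm n F"
      by (subst nn_integral_cmult) auto
  qed
  also have "\<dots> = L1_norm n F * L1_norm n G"
    unfolding L1_norm_def by (subst nn_integral_multc) (auto simp: mult.commute)
  finally show ?thesis by (simp add: F_def G_def H_def K_def)
qed

text \<open>
  \<open>L1_product_lower\<close> is integrated over $u$ with the weight $f(u/2)$. A factor $\int f$ is
  cancelled at the end, which is possible if it is neither $0$ nor infinite. If it is $0$, so is the
  left-hand side; if it is infinite, so are both factors on the right, as $f \le f \star_0 \phi$.
\<close>

lemma log_concave_ruzsa_inequality:
  assumes f: "peaked_log_concave n f" and g: "peaked_log_concave n g" and h: "peaked_log_concave n h"
  shows "L1_norm n f * L1_norm n (alpha_sum n 0 (alpha_sum n 0 f g) h)
       \<le> ennreal (4 ^ n) * (L1_norm n (alpha_sum n 0 f g) * L1_norm n (alpha_sum n 0 f h))"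
proof -
  let ?M = "Rn_lborel n"
  define I where "I = L1_norm n f"
  define J where "J = L1_norm n (alpha_sum n 0 (alpha_sum n 0 f g) h)"
  define R where "R = L1_norm n (alpha_sum n 0 f g) * L1_norm n (alpha_sum n 0 f h)"
  define K where "K u = (\<integral>\<^sup>+s. ennreal (f s powr (1/2) * f (vsub n u s) powr (1/2)) \<partial>?M)" for u
  note [measurable] = peaked_log_concave_measurable[OF f]
  note B = peaked_log_concaveD(1,2)[OF f]
  have Km [measurable]: "K \<in> borel_measurable ?M"
    unfolding K_def
    by (intro sigma_finite_measure.borel_measurable_nn_integral[OF sigma_finite_Rn_lborel]) measurable
  have weight: "(\<integral>\<^sup>+u. ennreal (f (vscale n (1/2) u)) \<partial>?M) = ennreal (2 ^ n) * I"
  proof -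
    have eq: "vadd n (vzero n) (vscale n (1/2) u) = vscale n (1/2) u" for u
      by (auto simp: vect_defs fun_eq_iff)
    have "I = ennreal ((1/2) ^ n) * (\<integral>\<^sup>+u. ennreal (f (vscale n (1/2) u)) \<partial>?M)"
      unfolding I_def L1_norm_def
      by (subst nn_integral_Rn_affine[of _ _ "1/2" "vzero n"]) (auto simp: eq)
    then have "ennreal (2 ^ n) * I
        = (ennreal (2 ^ n) * ennreal ((1/2) ^ n)) * (\<integral>\<^sup>+u. ennreal (f (vscale n (1/2) u)) \<partial>?M)"
      by (simp add: mult.assoc)
    also have "ennreal (2 ^ n) * ennreal ((1/2) ^ n) = 1"
      by (simp add: ennreal_mult[symmetric] power_mult_distrib[symmetric])
    finally show ?thesis by simp
  qed
  have square: "I * I \<le> (\<integral>\<^sup>+u. ennreal (f (vscale n (1/2) u)) * K u \<partial>?M)"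
  proof -
    have "I * I = (\<integral>\<^sup>+s. ennreal (f s) * I \<partial>?M)"
      unfolding I_def L1_norm_def by (subst nn_integral_multc) auto
    also have "\<dots> = (\<integral>\<^sup>+s. (\<integral>\<^sup>+u. ennreal (f s) * ennreal (f (vsub n u s)) \<partial>?M) \<partial>?M)"
    proof (rule nn_integral_cong)
      fix s assume s [measurable]: "s \<in> space ?M"
      have "(\<integral>\<^sup>+u. ennreal (f (vsub n u s)) \<partial>?M) = I"
        unfolding I_def L1_norm_def using s by (intro nn_integral_Rn_translate) auto
      then show "ennreal (f s) * I = (\<integral>\<^sup>+u. ennreal (f s) * ennreal (f (vsub n u s)) \<partial>?M)"
        by (subst nn_integral_cmult) auto
    qed
    also have "\<dots> = (\<integral>\<^sup>+u. (\<integral>\<^sup>+s. ennreal (f s) * ennreal (f (vsub n u s)) \<partial>?M) \<partial>?M)"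
      by (rule nn_integral_Rn_swap) measurable
    also have "\<dots> \<le> (\<integral>\<^sup>+u. ennreal (f (vscale n (1/2) u)) * K u \<partial>?M)"
    proof (rule nn_integral_mono)
      fix u assume u [measurable]: "u \<in> space ?M"
      have "ennreal (f s) * ennreal (f (vsub n u s))
          \<le> ennreal (f (vscale n (1/2) u)) * ennreal (f s powr (1/2) * f (vsub n u s) powr (1/2))"
        if s: "s \<in> Rn n" for s
      proof -
        let ?q = "f s powr (1/2) * f (vsub n u s) powr (1/2)"
        have "vadd n (vscale n (1/2) s) (vscale n (1 - 1/2) (vsub n u s)) = vscale n (1/2) u"
          by (auto simp: vect_defs fun_eq_iff field_simps)
        then have "?q \<le> f (vscale n (1/2) u)"
          using peaked_log_concaveD(5)[OF f s, of "vsub n u s" "1/2"] by simp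
        then have "?q * ?q \<le> f (vscale n (1/2) u) * ?q" by (intro mult_right_mono) auto
        also have "?q * ?q = (f s powr (1/2) * f s powr (1/2))
            * (f (vsub n u s) powr (1/2) * f (vsub n u s) powr (1/2))"
          by (simp only: mult_ac)
        also have "\<dots> = f s * f (vsub n u s)"
          using B(1)[OF s] B(1)[of "vsub n u s"] by (simp add: powr_half_sqrt)
        finally show ?thesis
          using B(1)[OF s] B(1) by (simp add: ennreal_mult[symmetric] ennreal_leI)
      qed
      then have "(\<integral>\<^sup>+s. ennreal (f s) * ennreal (f (vsub n u s)) \<partial>?M)
          \<le> (\<integral>\<^sup>+s. ennreal (f (vscale n (1/2) u))
                 * ennreal (f s powr (1/2) * f (vsub n u s) powr (1/2)) \<partial>?M)"
        by (intro nn_integral_mono) simp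
      also have "\<dots> = ennreal (f (vscale n (1/2) u)) * K u"
        unfolding K_def by (rule nn_integral_cmult) measurable
      finally show "(\<integral>\<^sup>+s. ennreal (f s) * ennreal (f (vsub n u s)) \<partial>?M)
          \<le> ennreal (f (vscale n (1/2) u)) * K u" .
    qed
    finally show ?thesis .
  qed
  have "ennreal ((1/2) ^ n) * J * (I * I)
      \<le> ennreal ((1/2) ^ n) * J * (\<integral>\<^sup>+u. ennreal (f (vscale n (1/2) u)) * K u \<partial>?M)"
    by (rule mult_left_mono[OF square]) simp
  also have "\<dots> = (\<integral>\<^sup>+u. (ennreal ((1/2) ^ n) * J) * (ennreal (f (vscale n (1/2) u)) * K u) \<partial>?M)"
    by (rule nn_integral_cmult[symmetric]) measurable
  also have "\<dots> \<le> (\<integral>\<^sup>+u. ennreal (f (vscale n (1/2) u)) * R \<partial>?M)"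
  proof (rule nn_integral_mono)
    fix u assume "u \<in> space ?M"
    then have "ennreal ((1/2) ^ n) * (J * K u) \<le> R"
      using L1_product_lower[OF f g h, of u] by (simp add: J_def R_def K_def)
    then have "ennreal (f (vscale n (1/2) u)) * (ennreal ((1/2) ^ n) * (J * K u))
        \<le> ennreal (f (vscale n (1/2) u)) * R"
      by (rule mult_left_mono) simp
    then show "(ennreal ((1/2) ^ n) * J) * (ennreal (f (vscale n (1/2) u)) * K u)
        \<le> ennreal (f (vscale n (1/2) u)) * R"
      by (simp only: mult_ac)
  qed
  also have "\<dots> = ennreal (2 ^ n) * I * R"
    by (subst nn_integral_multc) (auto simp: weight)
  finally have main: "ennreal ((1/2) ^ n) * J * (I * I) \<le> ennreal (2 ^ n) * I * R" .
  have "ennreal (2 ^ n) * (ennreal ((1/2) ^ n) * J * (I * I))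
      \<le> ennreal (2 ^ n) * (ennreal (2 ^ n) * I * R)"
    by (rule mult_left_mono[OF main]) simp
  moreover have "ennreal (2 ^ n) * ennreal ((1/2) ^ n) = 1"
    by (simp add: ennreal_mult[symmetric] power_mult_distrib[symmetric])
  moreover have "ennreal (2 ^ n) * ennreal (2 ^ n) = ennreal (4 ^ n)"
    by (simp add: ennreal_mult[symmetric] power_mult_distrib[symmetric])
  ultimately have cancel: "I * (I * J) \<le> I * (ennreal (4 ^ n) * R)"
    by (metis mult.assoc mult.commute mult_1)
  have le: "I \<le> L1_norm n (alpha_sum n 0 f \<phi>)" if \<phi>: "peaked_log_concave n \<phi>" for \<phi>
    unfolding I_def L1_norm_def
  proof (intro nn_integral_mono ennreal_leI)
    fix x assume "x \<in> space ?M"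
    then have "f x * \<phi> (vzero n) \<le> alpha_sum n 0 f \<phi> x"
      by (intro sup_convolution_upper[OF f \<phi>]) (auto simp: Rn_def vect_defs fun_eq_iff PiE_iff extensional_def)
    then show "f x \<le> alpha_sum n 0 f \<phi> x" by (simp add: peaked_log_concaveD(3)[OF \<phi>])
  qed
  have "I * J \<le> ennreal (4 ^ n) * R"
  proof (cases "I = 0 \<or> I = \<infinity>")
    case True
    have "R = \<infinity>" if "I = \<infinity>"
      using le[OF g] le[OF h] that by (simp add: R_def top_unique)
    then show ?thesis using True by (auto simp: ennreal_mult_top)
  next
    case False
    then show ?thesis using cancel by (simp add: ennreal_mult_le_mult_iff)
  qed
  then show ?thesis by (simp add: I_def J_def R_def)
qed

section \<open>Gamma mixtures and the comparison of integrals\<close>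

lemma nn_integral_gamma:
  fixes p r :: real
  assumes "p > 0" "r > 0"
  shows "(\<integral>\<^sup>+t. ennreal (indicator {0..} t * (t powr (p - 1) * exp (- (r * t)))) \<partial>lborel)
       = ennreal (Gamma p / r powr p)"
proof -
  define \<psi> where "\<psi> t = indicator {0..} t * (t powr (p - 1) * exp (- (r * t)))" for t :: real
  have [measurable]: "\<psi> \<in> borel_measurable borel" unfolding \<psi>_def by measurable
  have "ennreal (Gamma p)
      = ennreal r * (\<integral>\<^sup>+t. ennreal (indicator {0..} (0 + r * t) * (0 + r * t) powr (p - 1) / exp (0 + r * t)) \<partial>lborel)"
    unfolding Gamma_conv_nn_integral_real[OF \<open>p > 0\<close>]
    using \<open>r > 0\<close> by (subst nn_integral_real_affine[of _ r 0]) auto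
  also have "(\<lambda>t. ennreal (indicator {0..} (0 + r * t) * (0 + r * t) powr (p - 1) / exp (0 + r * t)))
      = (\<lambda>t. ennreal (r powr (p - 1)) * ennreal (\<psi> t))"
    using \<open>r > 0\<close>
    by (auto simp: fun_eq_iff \<psi>_def ennreal_mult[symmetric] powr_mult exp_minus field_simps
        zero_le_mult_iff split: split_indicator)
  also have "ennreal r * (\<integral>\<^sup>+t. ennreal (r powr (p - 1)) * ennreal (\<psi> t) \<partial>lborel)
      = ennreal (r powr p) * (\<integral>\<^sup>+t. ennreal (\<psi> t) \<partial>lborel)"
    using \<open>r > 0\<close>
    by (simp add: nn_integral_cmult mult.assoc[symmetric] ennreal_mult[symmetric] powr_mult_base)
  finally have "ennreal (1 / r powr p) * ennreal (Gamma p)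
      = (ennreal (1 / r powr p) * ennreal (r powr p)) * (\<integral>\<^sup>+t. ennreal (\<psi> t) \<partial>lborel)"
    by (simp add: mult.assoc)
  also have "ennreal (1 / r powr p) * ennreal (r powr p) = 1"
    using \<open>r > 0\<close> by (simp add: ennreal_mult[symmetric])
  finally show ?thesis
    using \<open>p > 0\<close> \<open>r > 0\<close> by (simp add: \<psi>_def ennreal_mult[symmetric] Gamma_real_pos less_imp_le)
qed

text \<open>
  The Gamma density with shape and rate both equal to $m$, so that its Laplace transform at $v$ is
  $(1 + v/m)^{-m}$.
\<close>

definition gamma_density :: "real \<Rightarrow> real \<Rightarrow> real" where
  "gamma_density m t = m powr m / Gamma m * (indicator {0..} t * (t powr (m - 1) * exp (- (m * t))))"

lemma gamma_density_nonneg: "m > 0 \<Longrightarrow> 0 \<le> gamma_density m t"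
  by (simp add: gamma_density_def Gamma_real_pos less_imp_le)

lemma gamma_density_measurable [measurable]: "gamma_density m \<in> borel_measurable borel"
  unfolding gamma_density_def by measurable

lemma gamma_density_moment:
  assumes "m > 0" "p < m"
  shows "(\<integral>\<^sup>+t. ennreal (gamma_density m t * t powr (- p)) \<partial>lborel)
       = ennreal (m powr p * Gamma (m - p) / Gamma m)"
proof -
  have "(\<lambda>t. ennreal (gamma_density m t * t powr (- p)))
      = (\<lambda>t. ennreal (m powr m / Gamma m)
          * ennreal (indicator {0..} t * (t powr (m - p - 1) * exp (- (m * t)))))"
    using assms
    by (auto simp: fun_eq_iff gamma_density_def ennreal_mult[symmetric] Gamma_real_pos less_imp_le
        powr_add[symmetric] algebra_simps split: split_indicator)
  then have "(\<integral>\<^sup>+t. ennreal (gamma_density m t * t powr (- p)) \<partial>lborel)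
      = ennreal (m powr m / Gamma m) * ennreal (Gamma (m - p) / m powr (m - p))"
    using assms by (simp add: nn_integral_cmult nn_integral_gamma)
  also have "\<dots> = ennreal (m powr p * Gamma (m - p) / Gamma m)"
    using assms
    by (simp add: ennreal_mult[symmetric] Gamma_real_pos less_imp_le powr_diff)
  finally show ?thesis .
qed

lemma gamma_density_total:
  assumes "m > 0"
  shows "(\<integral>\<^sup>+t. ennreal (gamma_density m t) \<partial>lborel) = 1"
proof -
  have eq: "gamma_density m t * t powr (- 0) = gamma_density m t" for t
    by (auto simp: gamma_density_def)
  have "Gamma m \<noteq> 0" using Gamma_real_pos[OF assms] by linarith
  then show ?thesis
    using gamma_density_moment[of m 0, unfolded eq] assms by simp
qed

text \<open>
  Writing $t^s = e^{s \ln t}$, the integral is the Laplace transform of the density at $-\ln t$.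
\<close>

lemma log_to_alpha_gamma_mixture:
  assumes \<alpha>: "\<alpha> < 0" and t: "0 \<le> t" "t \<le> 1"
  shows "ennreal (log_to_alpha \<alpha> t)
       = (\<integral>\<^sup>+s. ennreal (gamma_density (- 1 / \<alpha>) s) * ennreal (t powr s) \<partial>lborel)"
proof (cases "t = 0")
  case True
  then show ?thesis by (simp add: log_to_alpha_def)
next
  case False
  define m where "m = - 1 / \<alpha>"
  have m: "m > 0" "\<alpha> = - 1 / m" using \<alpha> by (auto simp: m_def divide_simps)
  have tpos: "0 < t" using False t by simp
  then have r: "0 < m - ln t" using m t by (smt (verit) ln_le_zero_iff)
  have "(\<lambda>s. ennreal (gamma_density m s) * ennreal (t powr s))
      = (\<lambda>s. ennreal (m powr m / Gamma m)
          * ennreal (indicator {0..} s * (s powr (m - 1) * exp (- ((m - ln t) * s)))))"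
    using m tpos
    by (auto simp: fun_eq_iff gamma_density_def ennreal_mult[symmetric] Gamma_real_pos less_imp_le
        powr_def[of t] exp_add[symmetric] algebra_simps split: split_indicator)
  then have "(\<integral>\<^sup>+s. ennreal (gamma_density m s) * ennreal (t powr s) \<partial>lborel)
      = ennreal (m powr m / Gamma m) * ennreal (Gamma m / (m - ln t) powr m)"
    using m r by (simp add: nn_integral_cmult nn_integral_gamma)
  also have "\<dots> = ennreal ((m / (m - ln t)) powr m)"
    using m(1) r Gamma_real_pos[OF m(1)] less_imp_neq[OF Gamma_real_pos[OF m(1)], symmetric]
    by (simp add: ennreal_mult[symmetric] powr_divide)
  also have "(m / (m - ln t)) powr m = ((m - ln t) / m) powr (- m)"
    using m(1) r by (simp add: powr_minus powr_divide)
  also have "(m - ln t) / m = 1 + \<alpha> * ln t" using m(1) by (simp add: m(2) field_simps)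
  also have "(1 + \<alpha> * ln t) powr (- m) = log_to_alpha \<alpha> t"
    using \<alpha> False by (simp add: log_to_alpha_def m_def)
  finally show ?thesis by (simp add: m_def)
qed

lemma Gamma_falling_product:
  fixes m :: real
  assumes "real n < m"
  shows "Gamma (m - real n) * (\<Prod>j=1..n. (m - real j)) = Gamma m"
  using assms
proof (induction n)
  case (Suc n)
  have "Gamma (m - real n) = (m - real (Suc n)) * Gamma (m - real (Suc n))"
    using Gamma_plus1[of "m - real (Suc n)"] Suc.prems nonpos_Ints_nonpos[of "m - real (Suc n)"]
    by force
  then show ?case using Suc by (simp add: mult_ac)
qed simp

text \<open>
  This is where the product in the theorem comes from: with $m = -1/\alpha$ the moment is
  $m^n \Gamma(m - n) / \Gamma(m)$ and $\Gamma(m) = \Gamma(m - n) \prod_{j \le n} (m - j)$. The moment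
  is finite exactly for $n < m$, that is, for $\alpha > -1/n$.
\<close>

lemma gamma_density_neg_moment:
  assumes \<alpha>: "\<alpha> < 0" and n: "real n < - 1 / \<alpha>"
  shows "(\<integral>\<^sup>+t. ennreal (gamma_density (- 1 / \<alpha>) t * t powr (- real n)) \<partial>lborel)
       = ennreal (1 / (\<Prod>j=1..n. (1 + real j * \<alpha>)))"
proof -
  define m where "m = - 1 / \<alpha>"
  have m: "m > 0" "\<alpha> = - 1 / m" "real n < m" using \<alpha> n by (auto simp: m_def divide_simps)
  have "(\<Prod>j=1..n. (1 + real j * \<alpha>)) = (\<Prod>j=1..n. (m - real j) / m)"
    using m(1) by (intro prod.cong) (auto simp: m(2) field_simps)
  also have "\<dots> = (\<Prod>j=1..n. (m - real j)) / m ^ n"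
    by (simp add: prod_dividef)
  finally have P: "(\<Prod>j=1..n. (1 + real j * \<alpha>)) = (\<Prod>j=1..n. (m - real j)) / m ^ n" .
  have "Gamma (m - real n) \<noteq> 0" using Gamma_real_pos[of "m - real n"] m(3) by linarith
  then have "m powr real n * Gamma (m - real n) / Gamma m = 1 / (\<Prod>j=1..n. (1 + real j * \<alpha>))"
    unfolding P Gamma_falling_product[OF m(3), symmetric] using m by (simp add: powr_realpow)
  then show ?thesis using gamma_density_moment[OF m(1,3)] by (simp add: m_def)
qed

text \<open>
  For $s \ge 1$ one has $f^s \le f$. For $s < 1$, concavity between $x$ and $0$ gives
  $f(x)^s \le f(s x)$, and the dilation contributes $s^{-n}$. The sum of the two bounds serves both
  ranges of $s$.
\<close>

lemma L1_norm_power_le: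
  assumes f: "peaked_log_concave n f" and s: "s > 0"
  shows "(\<integral>\<^sup>+x. ennreal (f x powr s) \<partial>Rn_lborel n) \<le> ennreal (1 + s powr (- real n)) * L1_norm n f"
proof (cases "s \<ge> 1")
  case True
  have "f x powr s \<le> f x" if "x \<in> Rn n" for x
    using powr_mono'[OF True peaked_log_concaveD(1,2)[OF f that]] peaked_log_concaveD(1)[OF f that] by simp
  then have "(\<integral>\<^sup>+x. ennreal (f x powr s) \<partial>Rn_lborel n) \<le> 1 * L1_norm n f"
    unfolding L1_norm_def by (auto intro!: nn_integral_mono ennreal_leI)
  also have "\<dots> \<le> ennreal (1 + s powr (- real n)) * L1_norm n f"
    by (intro mult_right_mono) (auto simp flip: ennreal_1 intro!: ennreal_leI)
  finally show ?thesis .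
next
  case False
  note [measurable] = peaked_log_concave_measurable[OF f]
  have dil: "vadd n (vzero n) (vscale n s x) = vscale n s x" for x
    by (auto simp: vect_defs fun_eq_iff)
  have "f x powr s \<le> f (vscale n s x)" if x: "x \<in> Rn n" for x
  proof -
    have "vadd n (vscale n s x) (vscale n (1 - s) (vzero n)) = vscale n s x"
      by (auto simp: vect_defs fun_eq_iff)
    then show ?thesis
      using peaked_log_concaveD(5)[OF f x, of "vzero n" s] peaked_log_concaveD(3)[OF f] False s by simp
  qed
  then have "(\<integral>\<^sup>+x. ennreal (f x powr s) \<partial>Rn_lborel n)
      \<le> (\<integral>\<^sup>+x. ennreal (f (vscale n s x)) \<partial>Rn_lborel n)" (is "_ \<le> ?J")
    by (auto intro!: nn_integral_mono ennreal_leI)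
  also have "\<dots> = ennreal (s powr (- real n)) * L1_norm n f"
  proof -
    have "L1_norm n f = ennreal (s ^ n) * ?J"
      unfolding L1_norm_def
      by (subst nn_integral_Rn_affine[OF _ s, of _ _ "vzero n"]) (auto simp: dil)
    moreover have "ennreal (s powr (- real n)) * ennreal (s ^ n) = 1"
      using s by (simp add: ennreal_mult[symmetric] powr_minus powr_realpow)
    ultimately show ?thesis by (simp add: mult.assoc[symmetric])
  qed
  also have "\<dots> \<le> ennreal (1 + s powr (- real n)) * L1_norm n f"
    by (intro mult_right_mono) (auto intro!: ennreal_leI)
  finally show ?thesis .
qed

lemma alpha_product_bounds:
  fixes \<alpha> :: real
  assumes "\<alpha> \<le> 0" "- 1 / real n < \<alpha>"
  shows "0 < (\<Prod>j=1..n. (1 + real j * \<alpha>))" "(\<Prod>j=1..n. (1 + real j * \<alpha>)) \<le> 1"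
proof -
  have *: "0 < 1 + real j * \<alpha>" "1 + real j * \<alpha> \<le> 1" if j: "j \<in> {1..n}" for j
  proof -
    have "- 1 < real n * \<alpha>" using assms(2) j by (simp add: field_simps)
    also have "real n * \<alpha> \<le> real j * \<alpha>" using j assms(1) by (intro mult_right_mono_neg) auto
    finally show "0 < 1 + real j * \<alpha>" by simp
    show "1 + real j * \<alpha> \<le> 1" using assms(1) by (simp add: mult_nonneg_nonpos)
  qed
  show "0 < (\<Prod>j=1..n. (1 + real j * \<alpha>))" using * by (intro prod_pos) auto
  show "(\<Prod>j=1..n. (1 + real j * \<alpha>)) \<le> 1" using * by (intro prod_le_1) (auto intro: less_imp_le)
qed

text \<open>
  Averaging \<open>L1_norm_power_le\<close> over the Gamma distribution gives the factor
  $1 + 1/\prod_{j \le n} (1 + j \alpha)$, in which the product is at most $1$. The Gamma distribution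
  degenerates at $\alpha = 0$, where the transformation is the identity.
\<close>

lemma L1_norm_log_to_alpha_le:
  assumes f: "peaked_log_concave n f" and \<alpha>: "\<alpha> \<le> 0" "- 1 / real n < \<alpha>" and n: "n \<ge> 1"
    and F: "\<And>x. x \<in> Rn n \<Longrightarrow> F x = log_to_alpha \<alpha> (f x)"
  shows "L1_norm n F \<le> ennreal (2 / (\<Prod>j=1..n. (1 + real j * \<alpha>))) * L1_norm n f"
proof (cases "\<alpha> = 0")
  case True
  have "L1_norm n F = 1 * L1_norm n f"
    unfolding L1_norm_def using F True by (auto intro!: nn_integral_cong simp: log_to_alpha_def)
  also have "\<dots> \<le> ennreal 2 * L1_norm n f" by (intro mult_right_mono) auto
  finally show ?thesis using True by simp
next
  case False
  then have neg: "\<alpha> < 0" using \<alpha> by simp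
  define m where "m = - 1 / \<alpha>"
  define P where "P = (\<Prod>j=1..n. (1 + real j * \<alpha>))"
  have P: "0 < P" "P \<le> 1" using alpha_product_bounds[OF \<alpha>] by (auto simp: P_def)
  have m: "m > 0" "real n < m" using neg \<alpha>(2) n by (auto simp: m_def field_simps)
  let ?M = "Rn_lborel n"
  let ?d = "\<lambda>s. ennreal (gamma_density m s)"
  note [measurable] = peaked_log_concave_measurable[OF f]
  have "L1_norm n F = (\<integral>\<^sup>+x. (\<integral>\<^sup>+s. ?d s * ennreal (f x powr s) \<partial>lborel) \<partial>?M)"
    unfolding L1_norm_def m_def
    using F peaked_log_concaveD(1,2)[OF f] by (auto intro!: nn_integral_cong simp: log_to_alpha_gamma_mixture[OF neg])
  also have "\<dots> = (\<integral>\<^sup>+s. (\<integral>\<^sup>+x. ?d s * ennreal (f x powr s) \<partial>?M) \<partial>lborel)"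
    by (rule pair_sigma_finite.Fubini'[symmetric])
       (auto simp: pair_sigma_finite_def sigma_finite_Rn_lborel lborel.sigma_finite_measure_axioms)
  also have "\<dots> \<le> (\<integral>\<^sup>+s. ennreal (gamma_density m s + gamma_density m s * s powr (- real n)) * L1_norm n f \<partial>lborel)"
  proof (rule nn_integral_mono)
    fix s :: real
    have "(\<integral>\<^sup>+x. ?d s * ennreal (f x powr s) \<partial>?M) = ?d s * (\<integral>\<^sup>+x. ennreal (f x powr s) \<partial>?M)"
      by (rule nn_integral_cmult) measurable
    also have "\<dots> \<le> ?d s * (ennreal (1 + s powr (- real n)) * L1_norm n f)"
    proof (cases "s > 0")
      case True
      then show ?thesis by (intro mult_left_mono L1_norm_power_le[OF f]) auto
    next
      case False
      then have "gamma_density m s = 0" by (cases "s = 0") (auto simp: gamma_density_def)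
      then show ?thesis by simp
    qed
    also have "\<dots> = ennreal (gamma_density m s + gamma_density m s * s powr (- real n)) * L1_norm n f"
      using gamma_density_nonneg[OF m(1), of s]
      by (simp add: mult.assoc[symmetric] ennreal_mult[symmetric] distrib_left)
    finally show "(\<integral>\<^sup>+x. ?d s * ennreal (f x powr s) \<partial>?M)
        \<le> ennreal (gamma_density m s + gamma_density m s * s powr (- real n)) * L1_norm n f" .
  qed
  also have "\<dots> = (\<integral>\<^sup>+s. ?d s + ennreal (gamma_density m s * s powr (- real n)) \<partial>lborel) * L1_norm n f"
    using gamma_density_nonneg[OF m(1)] by (subst nn_integral_multc) (auto simp: ennreal_plus)
  also have "(\<integral>\<^sup>+s. ?d s + ennreal (gamma_density m s * s powr (- real n)) \<partial>lborel)
      = 1 + ennreal (1 / P)"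
    using gamma_density_total[OF m(1)] gamma_density_neg_moment[OF neg m(2)[unfolded m_def]]
    by (subst nn_integral_add) (auto simp: m_def P_def)
  also have "1 + ennreal (1 / P) = ennreal (1 + 1 / P)" using P by (simp add: ennreal_plus)
  also have "\<dots> * L1_norm n f \<le> ennreal (2 / P) * L1_norm n f"
    using P by (intro mult_right_mono ennreal_leI) (auto simp: field_simps)
  finally show ?thesis by (simp add: P_def)
qed

text \<open>
  After taking logarithms this is $\ln (1 + x) \le x$ for $x = \alpha \ln t$, divided by the negative
  number $\alpha$.
\<close>

lemma le_log_to_alpha:
  assumes \<alpha>: "\<alpha> \<le> 0" and t: "0 \<le> t" "t \<le> 1"
  shows "t \<le> log_to_alpha \<alpha> t"
proof (cases "t = 0 \<or> \<alpha> = 0")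
  case True
  then show ?thesis by (auto simp: log_to_alpha_def)
next
  case False
  have base: "1 \<le> 1 + \<alpha> * ln t" using one_le_log_to_alpha_base[OF \<alpha>, of t] False t by simp
  then have "ln (1 + \<alpha> * ln t) \<le> \<alpha> * ln t" by (intro ln_add_one_self_le_self) simp
  then have "ln t \<le> ln (1 + \<alpha> * ln t) / \<alpha>" using False \<alpha> by (simp add: field_simps)
  then have "exp (ln t) \<le> exp (ln (1 + \<alpha> * ln t) / \<alpha>)" by (simp only: exp_le_cancel_iff)
  also have "\<dots> = log_to_alpha \<alpha> t" using False base by (simp add: log_to_alpha_def powr_def)
  finally show ?thesis using False t by simp
qed

lemma L1_norm_le_log_to_alpha:
  assumes f: "peaked_log_concave n f" and \<alpha>: "\<alpha> \<le> 0"
    and F: "\<And>x. x \<in> Rn n \<Longrightarrow> F x = log_to_alpha \<alpha> (f x)"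
  shows "L1_norm n f \<le> L1_norm n F"
  unfolding L1_norm_def using le_log_to_alpha[OF \<alpha>] peaked_log_concaveD(1,2)[OF f]
  by (auto intro!: nn_integral_mono ennreal_leI simp: F)

section \<open>The inequality for \<open>\<alpha>\<close>-concave functions\<close>

theorem theorem1p3:
  shows "\<exists>c::real. 0 < c \<and> c < 26 \<and>
    (\<forall>(n::nat) (\<alpha>::real) f g h.
       n \<ge> 1 \<longrightarrow> - 1 / real n < \<alpha> \<longrightarrow> \<alpha> \<le> 0 \<longrightarrow>
       f \<in> C_alpha n (ereal \<alpha>) \<longrightarrow> g \<in> C_alpha n (ereal \<alpha>) \<longrightarrow> h \<in> C_alpha n (ereal \<alpha>) \<longrightarrow>
       L1_norm n f * L1_norm n (alpha_sum n \<alpha> (alpha_sum n \<alpha> f g) h)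
         \<le> ennreal (c ^ n / (\<Prod>j=1..n. (1 + real j * \<alpha>)\<^sup>2))
             * (L1_norm n (alpha_sum n \<alpha> f g) * L1_norm n (alpha_sum n \<alpha> f h)))"
proof (intro exI[of _ 16] conjI allI impI)
  fix n :: nat and \<alpha> :: real and f g h :: "vect \<Rightarrow> real"
  assume n: "n \<ge> 1" and \<alpha>': "- 1 / real n < \<alpha>" and \<alpha>: "\<alpha> \<le> 0"
    and f: "f \<in> C_alpha n (ereal \<alpha>)" and g: "g \<in> C_alpha n (ereal \<alpha>)" and h: "h \<in> C_alpha n (ereal \<alpha>)"
  define f' where "f' x = alpha_to_log \<alpha> (f x)" for x
  define g' where "g' x = alpha_to_log \<alpha> (g x)" for x
  define h' where "h' x = alpha_to_log \<alpha> (h x)" for x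
  have plc: "peaked_log_concave n f'" "peaked_log_concave n g'" "peaked_log_concave n h'"
    using C_alpha_log_concave_transform(1)[OF f \<alpha>] C_alpha_log_concave_transform(1)[OF g \<alpha>]
      C_alpha_log_concave_transform(1)[OF h \<alpha>]
    by (auto simp: f'_def[abs_def] g'_def[abs_def] h'_def[abs_def])
  have rep: "\<And>x. x \<in> Rn n \<Longrightarrow> f x = log_to_alpha \<alpha> (f' x)"
    "\<And>x. x \<in> Rn n \<Longrightarrow> g x = log_to_alpha \<alpha> (g' x)" "\<And>x. x \<in> Rn n \<Longrightarrow> h x = log_to_alpha \<alpha> (h' x)"
    using C_alpha_log_concave_transform(2)[OF f \<alpha>] C_alpha_log_concave_transform(2)[OF g \<alpha>]
      C_alpha_log_concave_transform(2)[OF h \<alpha>]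
    by (auto simp: f'_def g'_def h'_def)
  have plc2: "peaked_log_concave n (alpha_sum n 0 f' g')" "peaked_log_concave n (alpha_sum n 0 f' h')"
    using plc by (auto intro: peaked_log_concave_sup_convolution)
  have plc3: "peaked_log_concave n (alpha_sum n 0 (alpha_sum n 0 f' g') h')"
    by (rule peaked_log_concave_sup_convolution[OF plc2(1) plc(3)])
  note fg = alpha_sum_log_to_alpha[OF plc(1,2) \<alpha> rep(1,2)]
  note fh = alpha_sum_log_to_alpha[OF plc(1,3) \<alpha> rep(1,3)]
  note fgh = alpha_sum_log_to_alpha[OF plc2(1) plc(3) \<alpha> fg rep(3)]
  define P where "P = (\<Prod>j=1..n. (1 + real j * \<alpha>))"
  have P: "0 < P" using alpha_product_bounds[OF \<alpha> \<alpha>'] by (simp add: P_def)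
  have "L1_norm n f * L1_norm n (alpha_sum n \<alpha> (alpha_sum n \<alpha> f g) h)
      \<le> (ennreal (2 / P) * L1_norm n f')
        * (ennreal (2 / P) * L1_norm n (alpha_sum n 0 (alpha_sum n 0 f' g') h'))"
    using L1_norm_log_to_alpha_le[OF plc(1) \<alpha> \<alpha>' n rep(1)]
      L1_norm_log_to_alpha_le[OF plc3 \<alpha> \<alpha>' n fgh]
    by (intro mult_mono) (auto simp: P_def)
  also have "\<dots> = ennreal (2 / P) * ennreal (2 / P)
      * (L1_norm n f' * L1_norm n (alpha_sum n 0 (alpha_sum n 0 f' g') h'))"
    by (simp only: mult_ac)
  also have "\<dots> \<le> ennreal (2 / P) * ennreal (2 / P)
      * (ennreal (4 ^ n) * (L1_norm n (alpha_sum n 0 f' g') * L1_norm n (alpha_sum n 0 f' h')))"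
    by (intro mult_left_mono log_concave_ruzsa_inequality plc) simp
  also have "\<dots> \<le> ennreal (2 / P) * ennreal (2 / P)
      * (ennreal (4 ^ n) * (L1_norm n (alpha_sum n \<alpha> f g) * L1_norm n (alpha_sum n \<alpha> f h)))"
    using L1_norm_le_log_to_alpha[OF plc2(1) \<alpha> fg] L1_norm_le_log_to_alpha[OF plc2(2) \<alpha> fh]
    by (intro mult_left_mono mult_mono) auto
  also have "\<dots> = ennreal (4 * 4 ^ n / P\<^sup>2)
      * (L1_norm n (alpha_sum n \<alpha> f g) * L1_norm n (alpha_sum n \<alpha> f h))"
    using P by (simp add: mult.assoc[symmetric] ennreal_mult[symmetric] power2_eq_square)
  also have "\<dots> \<le> ennreal (16 ^ n / P\<^sup>2)
      * (L1_norm n (alpha_sum n \<alpha> f g) * L1_norm n (alpha_sum n \<alpha> f h))"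
  proof (intro mult_right_mono ennreal_leI divide_right_mono)
    have "(4::real) ^ 1 \<le> 4 ^ n" using n by (intro power_increasing) auto
    then have "4 * 4 ^ n \<le> (4::real) ^ n * 4 ^ n" by simp
    also have "\<dots> = 16 ^ n" by (simp add: power_mult_distrib[symmetric])
    finally show "4 * 4 ^ n \<le> (16::real) ^ n" .
  qed auto
  finally show "L1_norm n f * L1_norm n (alpha_sum n \<alpha> (alpha_sum n \<alpha> f g) h)
      \<le> ennreal (16 ^ n / (\<Prod>j=1..n. (1 + real j * \<alpha>)\<^sup>2))
        * (L1_norm n (alpha_sum n \<alpha> f g) * L1_norm n (alpha_sum n \<alpha> f h))"
    by (simp add: P_def prod_power_distrib)
qed auto

end
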